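(* Assume the setting described in the context ($\xi$ integer-valued, in the domain of attraction of the normal law, $\alpha=2$, with normalising sequence $(a_n)$ and $b_n=n\mu$). Assume that $\mathbb P(\xi=x)$ is intermediate regularly varying and that $$\limsup_{x\to\infty}\frac{\sup_{y\ge x}\mathbb P(\xi=y)}{\mathbb P(\xi=x)}<+\infty .$$ Let $(x_n)$ be a sequence of positive integers with $\lim_{n\to\infty}\frac{x_n}{a_n}=\infty$. If $\lim_{n\to\infty}\frac{n\mathbb P(\xi=x_n)}{\mathbb P(S_n-\lfloor b_n\rfloor=x_n)}=s\in[0,1]$, then $$\mathscr L\Big(\frac{M_n}{x_n}\ \Big|\ S_n-\lfloor b_n\rfloor=x_n\Big)\xrightarrow[n\to\infty]{w}(1-s)\,\delta_0+s\,\delta_1,$$ where $\xrightarrow{w}$ denotes weak convergence.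
   Context: $\xi$ is an integer-valued random variable, $\xi_1,\xi_2,\dots$ are i.i.d. copies, $S_n=\sum_{i=1}^n\xi_i$, $M_n=\max\{\xi_1,\dots,\xi_n\}$. Setting "$\alpha=2$": $\mathbb E|\xi|<\infty$, $\mu=\mathbb E[\xi]$, and the truncated variance $\sigma^2(x)=\mathbb E[(\xi-\mu)^2\mathbf 1_{\{|\xi-\mu|\le x\}}]$ is slowly varying as $x\to\infty$ (the variance may be finite or infinite). $(a_n)$ is a positive sequence, $a_n\to\infty$, with $\sigma^2(a_n)a_n^{-2}\sim n^{-1}$; $b_n=n\mu$. $\mathscr L(X\mid A)$ is the law of $X$ conditioned on the event $A$; $\delta_z$ is the Dirac mass at $z$. A (eventually positive) function $f$ is intermediate regularly varying if $\lim_{\lambda\downarrow1}\liminf_{x\to\infty}\frac{f(\lambda x)}{f(x)}=\lim_{\lambda\downarrow1}\limsup_{x\to\infty}\frac{f(\lambda x)}{f(x)}=1$; for the integer-indexed function $x\mapsto\mathbb P(\xi=x)$ this is applied to $f(x)=\mathbb P(\xi=\lfloor x\rfloor)$. In the almost-monotonicity condition $x,y$ range over integers. *)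

theory Defs
  imports "HOL-Probability.Probability" "HOL-Library.Landau_Symbols"
begin

definition slowly_varying :: "(real \<Rightarrow> real) \<Rightarrow> bool" where
  "slowly_varying f \<longleftrightarrow>
     (\<forall>\<^sub>F x in at_top. 0 < f x) \<and>
     (\<forall>c>0. ((\<lambda>x. f (c * x) / f x) \<longlongrightarrow> 1) at_top)"

text \<open>The inner lower and upper limits live in the extended reals, as they may be infinite
  for some values of the dilation factor.\<close>

definition intermediate_regularly_varying :: "(real \<Rightarrow> real) \<Rightarrow> bool" where
  "intermediate_regularly_varying f \<longleftrightarrow>
     (\<forall>\<^sub>F x in at_top. 0 < f x) \<and>
     ((\<lambda>c. Liminf at_top (\<lambda>x. ereal (f (c * x) / f x))) \<longlongrightarrow> 1) (at_right 1) \<and>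
     ((\<lambda>c. Limsup at_top (\<lambda>x. ereal (f (c * x) / f x))) \<longlongrightarrow> 1) (at_right 1)"

definition truncated_variance :: "'a measure \<Rightarrow> ('a \<Rightarrow> int) \<Rightarrow> real \<Rightarrow> real" where
  "truncated_variance M \<xi> x =
     (let \<mu> = (\<integral>\<omega>. real_of_int (\<xi> \<omega>) \<partial>M)
      in \<integral>\<omega>. (real_of_int (\<xi> \<omega>) - \<mu>)\<^sup>2 * indicator {\<omega>. \<bar>real_of_int (\<xi> \<omega>) - \<mu>\<bar> \<le> x} \<omega> \<partial>M)"

definition iid_copies :: "'a measure \<Rightarrow> ('a \<Rightarrow> int) \<Rightarrow> (nat \<Rightarrow> 'a \<Rightarrow> int) \<Rightarrow> bool" where
  "iid_copies M \<xi> X \<longleftrightarrow>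
     prob_space.indep_vars M (\<lambda>_. count_space UNIV) X {1..} \<and>
     (\<forall>i\<ge>1. distr M (count_space UNIV) (X i) = distr M (count_space UNIV) \<xi>)"

definition partial_sum :: "(nat \<Rightarrow> 'a \<Rightarrow> int) \<Rightarrow> nat \<Rightarrow> 'a \<Rightarrow> int" where
  "partial_sum X n \<omega> = (\<Sum>i=1..n. X i \<omega>)"

definition partial_max :: "(nat \<Rightarrow> 'a \<Rightarrow> int) \<Rightarrow> nat \<Rightarrow> 'a \<Rightarrow> int" where
  "partial_max X n \<omega> = Max ((\<lambda>i. X i \<omega>) ` {1..n})"

text \<open>A probability measure only if the conditioning event has positive probability.\<close>

definition cond_law :: "'a measure \<Rightarrow> ('a \<Rightarrow> real) \<Rightarrow> ('a \<Rightarrow> bool) \<Rightarrow> real measure" where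
  "cond_law M Y P = distr (uniform_measure M {\<omega> \<in> space M. P \<omega>}) borel Y"

definition two_point_mixture :: "real \<Rightarrow> real \<Rightarrow> real \<Rightarrow> real measure" where
  "two_point_mixture s u v = measure_of UNIV (sets borel)
     (\<lambda>A. ennreal (1 - s) * emeasure (return borel u) A + ennreal s * emeasure (return borel v) A)"

lemma sets_two_point_mixture [simp, measurable_cong]: "sets (two_point_mixture s u v) = sets borel"
  by (metis sets.sigma_sets_eq sets_measure_of space_borel sets.space_closed two_point_mixture_def)

lemma space_two_point_mixture [simp]: "space (two_point_mixture s u v) = UNIV"
  by (simp add: two_point_mixture_def)

lemma emeasure_two_point_mixture:
  assumes "A \<in> sets borel"
  shows "emeasure (two_point_mixture s u v) A =
    ennreal (1 - s) * emeasure (return borel u) A + ennreal s * emeasure (return borel v) A"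
proof (rule emeasure_measure_of[OF two_point_mixture_def])
  show "countably_additive (sets (two_point_mixture s u v))
    (\<lambda>A. ennreal (1 - s) * emeasure (return borel u) A + ennreal s * emeasure (return borel v) A)"
    by (auto simp: countably_additive_def suminf_add[symmetric] suminf_indicator)
qed (use assms in \<open>auto simp: positive_def\<close>)

lemma real_distribution_two_point_mixture:
  assumes "s \<in> {0..1}"
  shows "real_distribution (two_point_mixture s u v)"
proof -
  have "ennreal (1 - s) + ennreal s = 1"
    using assms by (simp flip: ennreal_plus)
  then have "emeasure (two_point_mixture s u v) UNIV = 1"
    by (simp add: emeasure_two_point_mixture)
  then show ?thesis
    by (auto simp: real_distribution_def real_distribution_axioms_def intro!: prob_spaceI)
qed

end

(* One big jump. With z > 0 and A_n = {S_n - floor (b_n) = x_n}, the event {M_n > z x_n} \<inter> A_n is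
   split according to the index i of a large summand. Slow variation of the truncated variance gives,
   by truncation and Chebyshev, a weak law for S_n - \<xi>_i at every scale c x_n, since x_n / a_n tends
   to infinity; \<xi>_i is independent of it. If S_n - \<xi>_i is within c x_n of its mean, then A_n forces
   \<xi>_i to hit a value near x_n, which intermediate regular variation prices at (1 + o(1)) P(\<xi> = x_n);
   otherwise the price is still O(P(\<xi> = x_n)), and the weak law makes it negligible. Hence
   P(M_n > z x_n, A_n) / (n P(\<xi> = x_n)) tends to 1 for 0 < z < 1 and to 0 for z > 1, and dividing
   by P(A_n) gives the limit of the conditional distribution function. *)
theory Submission
  imports Defs
begin

text \<open>Three obstacles shape the proof. The mass function of \<open>\<xi>\<close> need not be
  monotone, and intermediate regular variation bounds each dilation factor separately, while a jump
  may hit any value in a window around \<open>x n\<close>. Measurability supplies the missing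
  uniformity, as in the uniform convergence theorem for regularly varying functions. Next, the
  variance may be infinite. Slow variation is used in the form
  \<open>V (2 * y) \<le> 3 / 2 * V y\<close> for large \<open>y\<close>; a factor above 1 holds
  eventually because the ratio tends to 1, and a factor below 2 makes \<open>V y / y\<close> decay
  along doublings. The later constants 6, 7 and 36 all come from the choice 3/2. Finally, the limit
  law may have atoms at 0 and 1, exactly where the jump asymptotics say nothing; weak convergence
  asks about these two points only when the atom is absent, and monotonicity in \<open>z\<close>
  then suffices. The probability of the conditioning event enters through the assumed limit
  \<open>s\<close>, so the mass without a big jump is obtained as a complement.\<close>

section \<open>Intermediate regular variation\<close>

text \<open>If an increment from \<open>t\<close> to \<open>t + u\<close> is large, then every intermediate point \<open>t + v\<close> is bad either
  relative to \<open>t\<close> or relative to \<open>t + u\<close>; but along sequences tending to infinity the sets of bad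
  offsets have vanishing measure by dominated convergence.\<close>

lemma uniform_increments:
  fixes h :: "real \<Rightarrow> real"
  assumes [measurable]: "h \<in> borel_measurable borel" and "e > 0"
    and pt: "\<And>u. 0 < u \<Longrightarrow> u < e \<Longrightarrow> eventually (\<lambda>t. \<bar>h (t + u) - h t\<bar> < d) at_top"
  shows "\<exists>T. \<forall>t\<ge>T. \<forall>u\<in>{0..e/2}. \<bar>h (t + u) - h t\<bar> < 2 * d"
proof (rule ccontr)
  assume "\<not> ?thesis"
  then have "\<forall>n::nat. \<exists>t u. t \<ge> real n \<and> u \<in> {0..e/2} \<and> \<bar>h (t + u) - h t\<bar> \<ge> 2 * d"
    by (meson not_le)
  then obtain t u where t: "\<And>n. t n \<ge> real n" and u: "\<And>n. u n \<in> {0..e/2}"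
    and tu: "\<And>n. \<bar>h (t n + u n) - h (t n)\<bar> \<ge> 2 * d"
    by metis
  define bad where "bad s = {w\<in>{0<..<e}. \<bar>h (s + w) - h s\<bar> \<ge> d}" for s
  have [measurable]: "bad s \<in> sets borel" for s
    unfolding bad_def by measurable
  have small: "(\<lambda>n. measure lborel (bad (s n))) \<longlonglongrightarrow> 0"
    if s: "filterlim s at_top sequentially" for s
  proof -
    have "(\<lambda>n. \<integral>w. indicator (bad (s n)) w \<partial>lborel) \<longlonglongrightarrow> (\<integral>w. (0::real) \<partial>(lborel :: real measure))"
    proof (rule integral_dominated_convergence[where w="indicator {0<..<e}"])
      show "AE w in lborel. (\<lambda>n. indicator (bad (s n)) w :: real) \<longlonglongrightarrow> 0"
      proof (intro AE_I2 tendsto_eventually)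
        fix w :: real
        show "\<forall>\<^sub>F n in sequentially. indicator (bad (s n)) w = (0::real)"
        proof (cases "w \<in> {0<..<e}")
          case True
          then have "\<forall>\<^sub>F n in sequentially. \<bar>h (s n + w) - h (s n)\<bar> < d"
            using pt[of w] s by (auto simp: filterlim_iff)
          then show ?thesis by eventually_elim (auto simp: bad_def)
        qed (auto simp: bad_def)
      qed
    qed (use \<open>e > 0\<close> in \<open>auto simp: bad_def indicator_def intro!: integrable_real_indicator\<close>)
    then show ?thesis by simp
  qed
  have t_lim: "filterlim t at_top sequentially"
    by (rule filterlim_at_top_mono[OF filterlim_real_sequentially]) (use t in auto)
  have tu_lim: "filterlim (\<lambda>n. t n + u n) at_top sequentially"
    by (rule filterlim_at_top_mono[OF t_lim]) (use u in auto)
  have "e / 2 \<le> measure lborel (bad (t n)) + measure lborel (bad (t n + u n))" for n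
  proof -
    \<comment> \<open>Translating by \<open>u n\<close> turns both bad sets into sets of offsets
      from the same point \<open>t n\<close>; Lebesgue measure is unchanged.\<close>
    let ?B = "(+) (- u n) -` bad (t n + u n)"
    have B: "?B \<in> sets borel" "emeasure lborel ?B = emeasure lborel (bad (t n + u n))"
    proof -
      show "?B \<in> sets borel"
        using measurable_sets[OF _ \<open>bad (t n + u n) \<in> sets borel\<close>, of "(+) (- u n)" borel] by simp
      have "emeasure (distr lborel borel ((+) (- u n))) (bad (t n + u n)) = emeasure lborel ?B"
        by (subst emeasure_distr) auto
      then show "emeasure lborel ?B = emeasure lborel (bad (t n + u n))"
        by (simp only: lborel_distr_plus)
    qed
    have fin: "emeasure lborel (bad s) < \<infinity>" for s
      by (rule le_less_trans[OF emeasure_mono[of _ "{0<..<e}"]]) (use \<open>e > 0\<close> in \<open>auto simp: bad_def\<close>)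
    \<comment> \<open>Only the upper half of the window is covered: since
      \<open>u n \<le> e / 2\<close>, it keeps \<open>v - u n\<close> inside the range of offsets on
      which \<open>bad\<close> is defined.\<close>
    have cover: "{e/2<..<e} \<subseteq> bad (t n) \<union> ?B"
    proof
      fix v assume v: "v \<in> {e/2<..<e}"
      have "d \<le> \<bar>h (t n + v) - h (t n)\<bar> \<or> d \<le> \<bar>h (t n + v) - h (t n + u n)\<bar>"
        using tu[of n] by linarith
      then show "v \<in> bad (t n) \<union> ?B"
      proof
        assume "d \<le> \<bar>h (t n + v) - h (t n)\<bar>"
        then show ?thesis using v \<open>e > 0\<close> by (auto simp: bad_def)
      next
        assume "d \<le> \<bar>h (t n + v) - h (t n + u n)\<bar>"
        then have "v - u n \<in> bad (t n + u n)" using v u[of n] by (auto simp: bad_def)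
        then show ?thesis by simp
      qed
    qed
    have "e / 2 = measure lborel {e/2<..<e}" using \<open>e > 0\<close> by simp
    also have "\<dots> \<le> measure lborel (bad (t n) \<union> ?B)"
      by (rule measure_mono_fmeasurable[OF cover]) (use fin[of "t n"] fin[of "t n + u n"] B in \<open>auto intro!: fmeasurable.Un intro: fmeasurableI\<close>)
    also have "\<dots> \<le> measure lborel (bad (t n)) + measure lborel ?B"
      by (rule measure_Un_le) (use B in auto)
    also have "measure lborel ?B = measure lborel (bad (t n + u n))"
      using B by (simp add: measure_def)
    finally show ?thesis .
  qed
  moreover have "(\<lambda>n. measure lborel (bad (t n)) + measure lborel (bad (t n + u n))) \<longlonglongrightarrow> 0 + 0"
    by (intro tendsto_add small t_lim tu_lim)
  ultimately have "e / 2 \<le> 0 + 0"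
    by (intro LIMSEQ_le_const) auto
  with \<open>e > 0\<close> show False by simp
qed

text \<open>Passing to \<open>ln (f (exp t))\<close> turns dilations into shifts, so that pointwise
  control of increments becomes uniform control. The result compares \<open>f\<close> at all pairs
  of nearby points at once, in both directions.\<close>

lemma intermediate_regularly_varying_uniform:
  fixes f :: "real \<Rightarrow> real"
  assumes [measurable]: "f \<in> borel_measurable borel" and irv: "intermediate_regularly_varying f" and "d > 0"
  shows "\<exists>r>1. \<exists>T>0. \<forall>y\<ge>T. \<forall>w\<ge>T. y / r \<le> w \<and> w \<le> r * y \<longrightarrow> 0 < f y \<and> f w \<le> exp d * f y"
proof -
  have pos: "\<forall>\<^sub>F x in at_top. 0 < f x"
    and li: "((\<lambda>c. Liminf at_top (\<lambda>x. ereal (f (c * x) / f x))) \<longlongrightarrow> 1) (at_right 1)"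
    and ls: "((\<lambda>c. Limsup at_top (\<lambda>x. ereal (f (c * x) / f x))) \<longlongrightarrow> 1) (at_right 1)"
    using irv by (auto simp: intermediate_regularly_varying_def)
  \<comment> \<open>Half of \<open>d\<close>, because \<open>uniform_increments\<close> doubles the
    pointwise bound.\<close>
  define \<delta> where "\<delta> = d / 2"
  have \<delta>: "exp (- \<delta>) < 1" "1 < exp \<delta>" using \<open>d > 0\<close> by (auto simp: \<delta>_def)
  have "\<forall>\<^sub>F c in at_right 1. ereal (exp (-\<delta>)) < Liminf at_top (\<lambda>x. ereal (f (c * x) / f x)) \<and>
     Limsup at_top (\<lambda>x. ereal (f (c * x) / f x)) < ereal (exp \<delta>)"
    using order_tendstoD(1)[OF li, of "ereal (exp (-\<delta>))"] order_tendstoD(2)[OF ls, of "ereal (exp \<delta>)"] \<delta>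
    by (auto simp: eventually_conj_iff one_ereal_def)
  then obtain b where b: "b > 1" "\<And>c. 1 < c \<Longrightarrow> c < b \<Longrightarrow> ereal (exp (-\<delta>)) < Liminf at_top (\<lambda>x. ereal (f (c * x) / f x)) \<and>
     Limsup at_top (\<lambda>x. ereal (f (c * x) / f x)) < ereal (exp \<delta>)"
    by (auto simp: eventually_at_right_field)
  define h where "h t = ln (f (exp t))" for t
  have [measurable]: "h \<in> borel_measurable borel" unfolding h_def by measurable
  have "\<exists>T. \<forall>t\<ge>T. \<forall>u\<in>{0..ln b/2}. \<bar>h (t + u) - h t\<bar> < 2 * \<delta>"
  proof (rule uniform_increments)
    show "0 < ln b" using b by simp
    fix u assume u: "0 < u" "u < ln b"
    have c: "1 < exp u" "exp u < b" using u b(1) by (auto, metis exp_less_mono exp_ln less_trans zero_less_one)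
    have "\<forall>\<^sub>F x in at_top. exp (-\<delta>) < f (exp u * x) / f x"
      using less_LiminfD[of "ereal (exp (-\<delta>))"] b(2)[OF c] by fastforce
    moreover have "\<forall>\<^sub>F x in at_top. f (exp u * x) / f x < exp \<delta>"
      using Limsup_lessD[of _ _ "ereal (exp \<delta>)"] b(2)[OF c] by fastforce
    moreover note pos
    ultimately have ev: "\<forall>\<^sub>F x in at_top. \<bar>ln (f (exp u * x)) - ln (f x)\<bar> < \<delta>"
    proof eventually_elim
      case (elim x)
      then have p: "0 < f (exp u * x)"
        by (metis exp_gt_zero less_trans zero_less_divide_iff not_less_iff_gr_or_eq)
      have "ln (f (exp u * x) / f x) > ln (exp (-\<delta>))" "ln (f (exp u * x) / f x) < ln (exp \<delta>)"
        using elim p by (auto intro!: ln_less_cancel_iff[THEN iffD2] simp del: ln_exp)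
      then show ?case using elim p by (simp add: ln_div abs_less_iff)
    qed
    have "\<forall>\<^sub>F t in at_top. \<bar>ln (f (exp u * exp t)) - ln (f (exp t))\<bar> < \<delta>"
      using ev exp_at_top by (auto simp: filterlim_iff)
    then show "\<forall>\<^sub>F t in at_top. \<bar>h (t + u) - h t\<bar> < \<delta>"
      by (simp add: h_def exp_add mult.commute)
  qed measurable
  then obtain T where T: "\<And>t u. t \<ge> T \<Longrightarrow> 0 \<le> u \<Longrightarrow> u \<le> ln b / 2 \<Longrightarrow> \<bar>h (t + u) - h t\<bar> < d"
    by (metis \<delta>_def atLeastAtMost_iff field_sum_of_halves mult_2)
  obtain T1 where T1: "\<And>x. x \<ge> T1 \<Longrightarrow> 0 < f x" using pos by (auto simp: eventually_at_top_linorder)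
  \<comment> \<open>The square root of \<open>b\<close>, because increments are controlled only up
    to \<open>ln b / 2\<close>.\<close>
  define r where "r = exp (ln b / 2)"
  define T2 where "T2 = max (exp T) T1"
  have r: "r > 1" using b by (simp add: r_def)
  have T2: "T2 > 0" "T2 \<ge> exp T" "T2 \<ge> T1" by (auto simp: T2_def less_max_iff_disj)
  show ?thesis
  proof (rule exI[of _ r], intro conjI r, rule exI[of _ T2], intro conjI allI impI T2)
    fix y w assume y: "y \<ge> T2" and w: "w \<ge> T2" and wy: "y / r \<le> w \<and> w \<le> r * y"
    have pos: "0 < y" "0 < w" "0 < f y" "0 < f w" using y w T2 T1[of y] T1[of w] by auto
    then show "0 < f y" by simp
    have l: "ln y \<ge> T" "ln w \<ge> T" using pos y w T2 by (auto simp: ln_ge_iff)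
    have "y \<le> r * w" using wy r by (simp add: field_simps)
    then have "ln y \<le> ln (r * w)" "ln w \<le> ln (r * y)" using wy pos r by auto
    then have "ln y \<le> ln b / 2 + ln w" "ln w \<le> ln b / 2 + ln y"
      using pos r by (auto simp: ln_mult r_def)
    \<comment> \<open>Increments are controlled to the right only, so the smaller of the two
      logarithms serves as the base point.\<close>
    then have "\<bar>h (ln w) - h (ln y)\<bar> < d"
      using T[of "ln y" "ln w - ln y"] T[of "ln w" "ln y - ln w"] l
      by (cases "ln y \<le> ln w") (auto simp: abs_minus_commute)
    then have "ln (f w) < d + ln (f y)" using pos by (simp add: h_def)
    then have "f w \<le> exp (d + ln (f y))" using pos by (metis exp_ln exp_less_mono less_imp_le)
    then show "f w \<le> exp d * f y" using pos by (simp add: exp_add)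
  qed
qed

text \<open>Almost monotonicity handles points to the right of the reference point only. For
  \<open>c < 1\<close> the reference point is moved left to \<open>y / r ^ m\<close>, which is at
  most \<open>c * y\<close>; coming back to \<open>y\<close> takes \<open>m\<close> uniform
  comparisons, each at the price of a factor \<open>exp 1\<close>.\<close>

lemma intermediate_regularly_varying_dominated:
  fixes f :: "real \<Rightarrow> real"
  assumes "f \<in> borel_measurable borel" and "intermediate_regularly_varying f"
    and mono: "\<And>y w. T0 \<le> y \<Longrightarrow> y \<le> w \<Longrightarrow> f w \<le> C0 * f y"
    and "c > 0"
  shows "\<exists>C>0. \<exists>T>0. \<forall>y\<ge>T. \<forall>w\<ge>c * y. f w \<le> C * f y"
proof -
  obtain r T where r: "r > 1" and T: "T > 0"
    and rT: "\<And>y w. T \<le> y \<Longrightarrow> T \<le> w \<Longrightarrow> y / r \<le> w \<Longrightarrow> w \<le> r * y \<Longrightarrow> 0 < f y \<and> f w \<le> exp 1 * f y"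
    using intermediate_regularly_varying_uniform[OF assms(1,2), of 1] by auto
  have f_pos: "0 < f v" if "v \<ge> T" for v
  proof -
    have "1 * v \<le> r * v" using r that T by (intro mult_right_mono) auto
    then show ?thesis using rT[of v v] r that by (simp add: pos_divide_le_eq mult.commute)
  qed
  have iter: "f (y / r ^ m) \<le> exp 1 ^ m * f y" if "y / r ^ m \<ge> T" for m y
    using that
  proof (induction m arbitrary: y)
    case (Suc m)
    have yp: "y > 0" using Suc.prems T r
      by (smt (verit) divide_nonpos_pos zero_less_power)
    have eq: "y / r ^ Suc m = y / r / r ^ m" by (simp add: field_simps)
    have "T \<le> y / r / r ^ m" using Suc.prems eq by simp
    also have "\<dots> \<le> y / r" using r yp by (simp add: divide_le_eq)
    finally have le: "T \<le> y / r" .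
    also have "y / r \<le> y" using r yp by (simp add: divide_le_eq)
    finally have "T \<le> y" .
    have "f (y / r) \<le> exp 1 * f y"
      using rT[of y "y / r"] le \<open>y / r \<le> y\<close> \<open>T \<le> y\<close> r yp
      by (smt (verit) mult_le_cancel_right1)
    have "f (y / r / r ^ m) \<le> exp 1 ^ m * f (y / r)"
      using Suc.IH[of "y / r"] Suc.prems unfolding eq by blast
    also have "\<dots> \<le> exp 1 ^ m * (exp 1 * f y)" using \<open>f (y / r) \<le> _\<close> by (intro mult_left_mono) auto
    finally show ?case using eq by (simp add: mult_ac)
  qed simp
  obtain m where m: "1 / c < r ^ m" using r real_arch_pow by blast
  then have m': "1 / r ^ m \<le> c" using \<open>c > 0\<close> r by (simp add: field_simps)
  \<comment> \<open>The factor \<open>r ^ m\<close> keeps \<open>y / r ^ m\<close> beyond both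
    thresholds after the move to the left.\<close>
  define T1 where "T1 = r ^ m * max T (max T0 0)"
  have T1: "y / r ^ m \<ge> T" "y / r ^ m \<ge> T0" "y \<ge> T" if "y \<ge> T1" for y
  proof -
    have "y / r ^ m \<ge> max T (max T0 0)" using that r unfolding T1_def by (subst pos_le_divide_eq) (simp_all add: mult.commute)
    then show "y / r ^ m \<ge> T" "y / r ^ m \<ge> T0" by auto
    then have "T * r ^ m \<le> y" using r by (simp add: pos_le_divide_eq)
    moreover have "T * 1 \<le> T * r ^ m" using T r by (intro mult_left_mono) auto
    ultimately show "y \<ge> T" by simp
  qed
  have T1p: "T1 > 0" using T r by (auto simp: T1_def less_max_iff_disj)
  show ?thesis
  proof (rule exI[of _ "(\<bar>C0\<bar> + 1) * exp 1 ^ m"], rule conjI, goal_cases)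
    case 2
    show ?case
    proof (rule exI[of _ T1], intro conjI allI impI T1p)
    fix y w assume y: "T1 \<le> y" and w: "c * y \<le> w"
    have yp: "y > 0" using y T1p by simp
    have "y / r ^ m \<le> c * y" using mult_right_mono[OF m', of y] yp by simp
    then have "f w \<le> C0 * f (y / r ^ m)" using w T1[OF y] by (intro mono) auto
    also have "0 < f (y / r ^ m)" by (rule f_pos) (rule T1[OF y])
    then have "C0 * f (y / r ^ m) \<le> (\<bar>C0\<bar> + 1) * f (y / r ^ m)" by (intro mult_right_mono) auto
    also have "\<dots> \<le> (\<bar>C0\<bar> + 1) * (exp 1 ^ m * f y)" using iter T1[OF y] by (intro mult_left_mono) auto
    finally show "f w \<le> (\<bar>C0\<bar> + 1) * exp 1 ^ m * f y" by (simp add: mult_ac)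
    qed
  qed simp
qed

section \<open>Truncated moments and a weak law\<close>

text \<open>A substitute for the Potter bounds. Each doubling of \<open>y\<close> multiplies
  \<open>V y / y\<close> by at most 3/4, and the single factor 3/2 pays for the last, incomplete
  doubling before \<open>w\<close>.\<close>

lemma (in prob_space) truncated_second_moment_le:
  fixes Y :: "'a \<Rightarrow> real" and V :: "real \<Rightarrow> real"
  defines "V \<equiv> \<lambda>y. \<integral>\<omega>. (Y \<omega>)\<^sup>2 * indicator {\<omega>. \<bar>Y \<omega>\<bar> \<le> y} \<omega> \<partial>M"
  assumes doubling: "\<And>y. y0 \<le> y \<Longrightarrow> V (2 * y) \<le> 3 / 2 * V y" and "0 < y0"
    and "y0 \<le> y" "y \<le> w"
  assumes [measurable]: "Y \<in> borel_measurable M"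
  shows "V w / w \<le> 3 / 2 * (V y / y)"
proof -
  have int: "integrable M (\<lambda>\<omega>. (Y \<omega>)\<^sup>2 * indicator {\<omega>. \<bar>Y \<omega>\<bar> \<le> v} \<omega>)" for v
  proof (rule integrable_const_bound[where B="v\<^sup>2"])
    show "AE \<omega> in M. norm ((Y \<omega>)\<^sup>2 * indicator {\<omega>. \<bar>Y \<omega>\<bar> \<le> v} \<omega>) \<le> v\<^sup>2"
      by (auto simp: indicator_def abs_le_square_iff[symmetric])
  qed measurable
  have V_mono: "V v \<le> V v'" if "v \<le> v'" for v v'
    unfolding V_def by (intro integral_mono int) (use that in \<open>auto simp: indicator_def\<close>)
  have V_nonneg: "0 \<le> V v" for v
    unfolding V_def by (intro integral_nonneg_AE) auto
  have "V w / w \<le> 3 / 2 * (V y / y)" if "y0 \<le> y" "y \<le> w" "w \<le> 2 ^ k * y" for k y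
    using that
  proof (induction k arbitrary: y)
    case 0
    then have "w = y" "0 \<le> V y / y" using V_nonneg[of y] \<open>0 < y0\<close> by auto
    then show ?case by simp
  next
    case (Suc k)
    have y: "y > 0" using Suc.prems \<open>0 < y0\<close> by simp
    show ?case
    proof (cases "w \<le> 2 * y")
      case True
      have "V w \<le> 3 / 2 * V y" using V_mono[OF True] doubling[of y] Suc.prems by simp
      then have "V w / w \<le> (3 / 2 * V y) / y"
        using Suc.prems y V_nonneg[of y] by (intro frac_le) auto
      then show ?thesis by simp
    next
      case False
      then have "V w / w \<le> 3 / 2 * (V (2 * y) / (2 * y))"
        using Suc.IH[of "2 * y"] Suc.prems y by (simp add: mult_ac)
      also have "V (2 * y) / (2 * y) \<le> V y / y"
        using doubling[of y] Suc.prems y V_nonneg[of y] by (simp add: field_simps)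
      finally show ?thesis by simp
    qed
  qed
  moreover obtain k where "w / y < 2 ^ k" using real_arch_pow[of 2 "w/y"] by auto
  then have "w \<le> 2 ^ k * y" using assms by (simp add: field_simps)
  ultimately show ?thesis using assms by blast
qed

text \<open>The constant 6 is the sum of a geometric series: the dyadic shell just above
  \<open>y\<close> contributes at most \<open>3 / 2 * (V y / y)\<close>, and the bounds for
  successive shells decrease by the factor 3/4. The lemma controls both the bias caused by
  truncation and the probability that truncation changes a summand.\<close>

lemma (in prob_space) truncated_mean_tail_le:
  fixes Y :: "'a \<Rightarrow> real" and V :: "real \<Rightarrow> real"
  defines "V \<equiv> \<lambda>y. \<integral>\<omega>. (Y \<omega>)\<^sup>2 * indicator {\<omega>. \<bar>Y \<omega>\<bar> \<le> y} \<omega> \<partial>M"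
  assumes [measurable]: "integrable M Y"
    and doubling: "\<And>y. y0 \<le> y \<Longrightarrow> V (2 * y) \<le> 3 / 2 * V y" and "0 < y0" and "y0 \<le> y"
  shows "(\<integral>\<omega>. \<bar>Y \<omega>\<bar> * indicator {\<omega>. y < \<bar>Y \<omega>\<bar>} \<omega> \<partial>M) \<le> 6 * (V y / y)"
proof -
  have [measurable]: "Y \<in> borel_measurable M" using assms by simp
  define m where "m v = (\<integral>\<omega>. \<bar>Y \<omega>\<bar> * indicator {\<omega>. v < \<bar>Y \<omega>\<bar>} \<omega> \<partial>M)" for v
  have int: "integrable M (\<lambda>\<omega>. (Y \<omega>)\<^sup>2 * indicator {\<omega>. \<bar>Y \<omega>\<bar> \<le> v} \<omega>)" for v
  proof (rule integrable_const_bound[where B="v\<^sup>2"])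
    show "AE \<omega> in M. norm ((Y \<omega>)\<^sup>2 * indicator {\<omega>. \<bar>Y \<omega>\<bar> \<le> v} \<omega>) \<le> v\<^sup>2"
      by (auto simp: indicator_def abs_le_square_iff[symmetric])
  qed measurable
  have int_m: "integrable M (\<lambda>\<omega>. \<bar>Y \<omega>\<bar> * indicator {\<omega>. v < \<bar>Y \<omega>\<bar>} \<omega>)" for v
    by (rule Bochner_Integration.integrable_bound[OF \<open>integrable M Y\<close>]) (auto simp: indicator_def)
  have V_nonneg: "0 \<le> V v" for v
    unfolding V_def by (intro integral_nonneg_AE) auto
  \<comment> \<open>By \<open>halve\<close> and the doubling bound, \<open>m v - 6 * (V v / v)\<close> does not decrease when \<open>v\<close> is doubled,
    while \<open>m v\<close> tends to 0.\<close>
  have halve: "m v \<le> m (2 * v) + V (2 * v) / v" if "v > 0" for v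
  proof -
    have "m v \<le> (\<integral>\<omega>. \<bar>Y \<omega>\<bar> * indicator {\<omega>. 2 * v < \<bar>Y \<omega>\<bar>} \<omega> + (Y \<omega>)\<^sup>2 * indicator {\<omega>. \<bar>Y \<omega>\<bar> \<le> 2 * v} \<omega> / v \<partial>M)"
      unfolding m_def
    proof (intro integral_mono int_m Bochner_Integration.integrable_add integrable_divide int)
      fix \<omega>
      have "\<bar>Y \<omega>\<bar> \<le> (Y \<omega>)\<^sup>2 / v" if "v < \<bar>Y \<omega>\<bar>"
        using mult_right_mono[of v "\<bar>Y \<omega>\<bar>" "\<bar>Y \<omega>\<bar>"] that \<open>v > 0\<close>
        by (simp add: field_simps power2_eq_square)
      then show "\<bar>Y \<omega>\<bar> * indicator {\<omega>. v < \<bar>Y \<omega>\<bar>} \<omega> \<le> \<bar>Y \<omega>\<bar> * indicator {\<omega>. 2 * v < \<bar>Y \<omega>\<bar>} \<omega> +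
          (Y \<omega>)\<^sup>2 * indicator {\<omega>. \<bar>Y \<omega>\<bar> \<le> 2 * v} \<omega> / v"
        using \<open>v > 0\<close> by (auto simp: indicator_def)
    qed
    also have "\<dots> = m (2 * v) + V (2 * v) / v"
      unfolding m_def V_def using int_m int by (subst Bochner_Integration.integral_add) auto
    finally show ?thesis .
  qed
  then have step: "m v - 6 * (V v / v) \<le> m (2 * v) - 6 * (V (2 * v) / (2 * v))" if "y0 \<le> v" for v
  proof -
    have "v > 0" using that \<open>0 < y0\<close> by simp
    moreover from this have "V (2 * v) / v \<le> (3 / 2 * V v) / v"
      using doubling[of v] that by (intro divide_right_mono) auto
    ultimately show ?thesis using halve[of v] by simp
  qed
  have iter: "m y - 6 * (V y / y) \<le> m (2 ^ k * y) - 6 * (V (2 ^ k * y) / (2 ^ k * y))" for k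
  proof (induction k)
    case (Suc k)
    have "y0 * 1 \<le> y * 2 ^ k" using assms by (intro mult_mono) auto
    then show ?case using step[of "2 ^ k * y"] Suc by (simp add: mult_ac)
  qed simp
  have "(\<lambda>k. m (2 ^ k * y)) \<longlonglongrightarrow> (\<integral>\<omega>. 0 \<partial>M)"
    unfolding m_def
  proof (rule integral_dominated_convergence[where w="\<lambda>\<omega>. \<bar>Y \<omega>\<bar>"])
    show "AE \<omega> in M. (\<lambda>k. \<bar>Y \<omega>\<bar> * indicator {\<omega>. 2 ^ k * y < \<bar>Y \<omega>\<bar>} \<omega>) \<longlonglongrightarrow> 0"
    proof (intro AE_I2 tendsto_eventually)
      fix \<omega>
      obtain K where "\<bar>Y \<omega>\<bar> / y < 2 ^ K" using real_arch_pow[of 2 "\<bar>Y \<omega>\<bar> / y"] by auto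
      moreover have "(2::real) ^ K \<le> 2 ^ k" if "k \<ge> K" for k using that by (intro power_increasing) auto
      ultimately have "\<bar>Y \<omega>\<bar> / y \<le> 2 ^ k" if "k \<ge> K" for k
        using that by (meson less_le_trans less_imp_le)
      then have "\<forall>\<^sub>F k in sequentially. \<bar>Y \<omega>\<bar> \<le> 2 ^ k * y"
        using assms(4,5) by (auto simp: eventually_sequentially pos_divide_le_eq)
      then show "\<forall>\<^sub>F k in sequentially. \<bar>Y \<omega>\<bar> * indicator {\<omega>. 2 ^ k * y < \<bar>Y \<omega>\<bar>} \<omega> = 0"
        by eventually_elim auto
    qed
  qed (use \<open>integrable M Y\<close> in \<open>auto simp: indicator_def\<close>)
  then have lim: "(\<lambda>k. m (2 ^ k * y)) \<longlonglongrightarrow> 0" by simp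
  have "m y - 6 * (V y / y) \<le> m (2 ^ k * y)" for k
  proof -
    have "0 \<le> V (2 ^ k * y) / (2 ^ k * y)"
      using V_nonneg assms(4,5) by (intro divide_nonneg_nonneg) auto
    then show ?thesis using iter[of k] by linarith
  qed
  then have "m y - 6 * (V y / y) \<le> 0"
    by (intro LIMSEQ_le_const[OF lim]) auto
  then show ?thesis by (simp add: m_def)
qed

text \<open>Chebyshev's inequality would call for a full second moment, which may be infinite, and
  \<open>V\<close> sees only values up to \<open>y\<close>. Markov's inequality for the first moment
  beyond \<open>y\<close> gives the same order.\<close>

lemma (in prob_space) tail_le_truncated_second_moment:
  fixes Y :: "'a \<Rightarrow> real" and V :: real
  assumes [measurable]: "integrable M Y" and "0 < y"
    and tail: "(\<integral>\<omega>. \<bar>Y \<omega>\<bar> * indicator {\<omega>. y < \<bar>Y \<omega>\<bar>} \<omega> \<partial>M) \<le> 6 * (V / y)"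
  shows "\<P>(\<omega> in M. y < \<bar>Y \<omega>\<bar>) \<le> 6 * (V / y\<^sup>2)"
proof -
  have [measurable]: "Y \<in> borel_measurable M" using assms by simp
  have "y * \<P>(\<omega> in M. y < \<bar>Y \<omega>\<bar>) = (\<integral>\<omega>. y * indicator {\<omega> \<in> space M. y < \<bar>Y \<omega>\<bar>} \<omega> \<partial>M)"
    by simp
  also have "\<dots> \<le> (\<integral>\<omega>. \<bar>Y \<omega>\<bar> * indicator {\<omega>. y < \<bar>Y \<omega>\<bar>} \<omega> \<partial>M)"
  proof (rule integral_mono)
    show "integrable M (\<lambda>\<omega>. y * indicat_real {\<omega> \<in> space M. y < \<bar>Y \<omega>\<bar>} \<omega>)"
      by (intro integrable_mult_right integrable_real_indicator) (auto simp: less_top[symmetric])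
    show "integrable M (\<lambda>\<omega>. \<bar>Y \<omega>\<bar> * indicator {\<omega>. y < \<bar>Y \<omega>\<bar>} \<omega>)"
      by (rule Bochner_Integration.integrable_bound[OF \<open>integrable M Y\<close>]) (auto simp: indicator_def)
  qed (auto simp: indicator_def)
  finally have "y * \<P>(\<omega> in M. y < \<bar>Y \<omega>\<bar>) \<le> 6 * (V / y)" using tail by simp
  then show ?thesis using \<open>0 < y\<close> by (simp add: field_simps power2_eq_square)
qed

text \<open>Truncation at \<open>y\<close> alters some summand with probability at most
  \<open>6 * r\<close>. The truncated sum is not recentred: its raw second moment consists of a
  diagonal part, giving \<open>r\<close>, and a squared bias of at most
  \<open>n * (6 * (V / y))\<close>, giving \<open>36 * r\<^sup>2\<close> after division by
  \<open>y\<^sup>2\<close>.\<close>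

lemma (in prob_space) iid_sum_tail_le:
  fixes Y :: "'i \<Rightarrow> 'a \<Rightarrow> real" and Y0 :: "'a \<Rightarrow> real" and V r y :: real
  defines "V \<equiv> \<integral>\<omega>. (Y0 \<omega>)\<^sup>2 * indicator {\<omega>. \<bar>Y0 \<omega>\<bar> \<le> y} \<omega> \<partial>M"
  assumes indep: "indep_vars (\<lambda>_. borel) Y I" and "finite I" "card I \<le> n"
    and ident: "\<And>i. i \<in> I \<Longrightarrow> distr M borel (Y i) = distr M borel Y0"
    and Y0: "integrable M Y0" "(\<integral>\<omega>. Y0 \<omega> \<partial>M) = 0" and "0 < y"
    and tail: "(\<integral>\<omega>. \<bar>Y0 \<omega>\<bar> * indicator {\<omega>. y < \<bar>Y0 \<omega>\<bar>} \<omega> \<partial>M) \<le> 6 * (V / y)"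
    and r: "r = real n * (V / y\<^sup>2)"
  shows "\<P>(\<omega> in M. y < \<bar>\<Sum>i\<in>I. Y i \<omega>\<bar>) \<le> 7 * r + 36 * r\<^sup>2"
proof -
  define \<tau> :: "real \<Rightarrow> real" where "\<tau> u = u * indicator {u. \<bar>u\<bar> \<le> y} u" for u
  have [measurable]: "Y0 \<in> borel_measurable M" using Y0 by simp
  have Y[measurable]: "Y i \<in> borel_measurable M" if "i \<in> I" for i
    using indep that by (auto simp: indep_vars_def)
  have [measurable]: "\<tau> \<in> borel_measurable borel" unfolding \<tau>_def by measurable
  have \<tau>: "\<bar>\<tau> u\<bar> \<le> y" for u using \<open>0 < y\<close> by (auto simp: \<tau>_def indicator_def)
  have same: "(\<integral>\<omega>. g (Y i \<omega>) \<partial>M) = (\<integral>\<omega>. g (Y0 \<omega>) \<partial>M)"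
    if [measurable]: "g \<in> borel_measurable borel" and i: "i \<in> I" for g :: "real \<Rightarrow> real" and i
    using integral_distr[OF Y[OF i], of g] integral_distr[of Y0 M borel g] ident[OF i] by simp
  have int: "integrable M (\<lambda>\<omega>. \<tau> (Z \<omega>))" if [measurable]: "Z \<in> borel_measurable M" for Z
    using \<tau> by (intro integrable_const_bound[where B=y]) auto
  have int2: "integrable M (\<lambda>\<omega>. \<tau> (Z \<omega>) * \<tau> (Z' \<omega>))"
    if [measurable]: "Z \<in> borel_measurable M" "Z' \<in> borel_measurable M" for Z Z'
  proof (rule integrable_const_bound[where B="y * y"])
    have "\<bar>\<tau> (Z \<omega>)\<bar> * \<bar>\<tau> (Z' \<omega>)\<bar> \<le> y * y" for \<omega>
      using \<tau> \<open>0 < y\<close> by (intro mult_mono) auto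
    then show "AE \<omega> in M. norm (\<tau> (Z \<omega>) * \<tau> (Z' \<omega>)) \<le> y * y" by (simp add: abs_mult)
  qed measurable
  define m where "m = (\<integral>\<omega>. \<tau> (Y0 \<omega>) \<partial>M)"
  \<comment> \<open>As \<open>Y0\<close> has mean zero, the mean of its truncation is minus the mean
    of the discarded tail.\<close>
  have m: "\<bar>m\<bar> \<le> 6 * (V / y)"
  proof -
    have int': "integrable M (\<lambda>\<omega>. Y0 \<omega> * indicator {\<omega>. y < \<bar>Y0 \<omega>\<bar>} \<omega>)"
      by (rule Bochner_Integration.integrable_bound[OF \<open>integrable M Y0\<close>]) (auto simp: indicator_def)
    have "0 = (\<integral>\<omega>. \<tau> (Y0 \<omega>) + Y0 \<omega> * indicator {\<omega>. y < \<bar>Y0 \<omega>\<bar>} \<omega> \<partial>M)"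
      unfolding Y0(2)[symmetric] by (intro Bochner_Integration.integral_cong) (auto simp: \<tau>_def indicator_def)
    also have "\<dots> = m + (\<integral>\<omega>. Y0 \<omega> * indicator {\<omega>. y < \<bar>Y0 \<omega>\<bar>} \<omega> \<partial>M)"
      unfolding m_def by (intro Bochner_Integration.integral_add int int') auto
    finally have "\<bar>m\<bar> = \<bar>\<integral>\<omega>. Y0 \<omega> * indicator {\<omega>. y < \<bar>Y0 \<omega>\<bar>} \<omega> \<partial>M\<bar>" by simp
    also have "\<dots> \<le> (\<integral>\<omega>. \<bar>Y0 \<omega> * indicator {\<omega>. y < \<bar>Y0 \<omega>\<bar>} \<omega>\<bar> \<partial>M)"
      by (rule integral_abs_bound)
    also have "\<dots> \<le> 6 * (V / y)" using tail by (simp add: abs_mult)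
    finally show ?thesis .
  qed
  have V_nonneg: "0 \<le> V" unfolding V_def by (intro integral_nonneg_AE) auto
  have cov: "(\<integral>\<omega>. \<tau> (Y i \<omega>) * \<tau> (Y j \<omega>) \<partial>M) \<le> (if i = j then V else 0) + m\<^sup>2"
    if "i \<in> I" "j \<in> I" for i j
  proof (cases "i = j")
    case True
    have "(\<integral>\<omega>. \<tau> (Y i \<omega>) * \<tau> (Y i \<omega>) \<partial>M) = (\<integral>\<omega>. \<tau> (Y0 \<omega>) * \<tau> (Y0 \<omega>) \<partial>M)"
      using that by (intro same) auto
    also have "\<dots> = V"
      unfolding V_def by (intro Bochner_Integration.integral_cong) (auto simp: \<tau>_def indicator_def power2_eq_square)
    finally show ?thesis using True by simp
  next
    case False
    have "indep_vars (\<lambda>_. borel) (\<lambda>i \<omega>. \<tau> (Y i \<omega>)) {i, j}"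
      using indep_vars_compose2[OF indep_vars_subset[OF indep, of "{i, j}"], of "\<lambda>_. \<tau>" "\<lambda>_. borel"] that by auto
    from indep_vars_lebesgue_integral[OF _ this]
    have "(\<integral>\<omega>. \<tau> (Y i \<omega>) * \<tau> (Y j \<omega>) \<partial>M) = (\<integral>\<omega>. \<tau> (Y i \<omega>) \<partial>M) * (\<integral>\<omega>. \<tau> (Y j \<omega>) \<partial>M)"
      using False that int[OF Y] by auto
    also have "\<dots> = m * m" unfolding m_def using that by (simp add: same)
    finally show ?thesis using False by (simp add: power2_eq_square)
  qed
  define S where "S \<omega> = (\<Sum>i\<in>I. \<tau> (Y i \<omega>))" for \<omega>
  have [measurable]: "S \<in> borel_measurable M" unfolding S_def by measurable
  have S2: "(S \<omega>)\<^sup>2 = (\<Sum>i\<in>I. \<Sum>j\<in>I. \<tau> (Y i \<omega>) * \<tau> (Y j \<omega>))" for \<omega>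
    by (simp add: S_def power2_eq_square sum_product)
  have intS: "integrable M (\<lambda>\<omega>. (S \<omega>)\<^sup>2)"
    unfolding S2 by (intro Bochner_Integration.integrable_sum int2 Y)
  have "(\<integral>\<omega>. (S \<omega>)\<^sup>2 \<partial>M) = (\<Sum>i\<in>I. \<Sum>j\<in>I. \<integral>\<omega>. \<tau> (Y i \<omega>) * \<tau> (Y j \<omega>) \<partial>M)"
    unfolding S2 by (subst Bochner_Integration.integral_sum; (intro Bochner_Integration.integrable_sum int2 Y sum.cong refl)?;
      (subst Bochner_Integration.integral_sum; (intro int2 Y refl)?)?)
  also have "\<dots> \<le> (\<Sum>i\<in>I. \<Sum>j\<in>I. (if i = j then V else 0) + m\<^sup>2)"
    by (intro sum_mono cov)
  also have "\<dots> = card I * V + (card I * m)\<^sup>2"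
    using \<open>finite I\<close> by (simp add: sum.distrib power_mult_distrib power2_eq_square algebra_simps)
  also have "\<dots> \<le> n * V + (n * (6 * (V / y)))\<^sup>2"
  proof (intro add_mono mult_right_mono V_nonneg)
    have "\<bar>real (card I) * m\<bar> \<le> n * (6 * (V / y))"
      unfolding abs_mult using m \<open>card I \<le> n\<close> by (intro mult_mono) auto
    then show "(real (card I) * m)\<^sup>2 \<le> (n * (6 * (V / y)))\<^sup>2"
      by (rule abs_le_square_iff[THEN iffD1, OF order_trans[OF _ abs_ge_self]])
  qed (use \<open>card I \<le> n\<close> in auto)
  finally have ES: "(\<integral>\<omega>. (S \<omega>)\<^sup>2 \<partial>M) \<le> n * V + (n * (6 * (V / y)))\<^sup>2" .
  have "\<P>(\<omega> in M. y\<^sup>2 \<le> (S \<omega>)\<^sup>2) \<le> (\<integral>\<omega>. (S \<omega>)\<^sup>2 \<partial>M) / y\<^sup>2"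
    using integral_Markov_inequality_measure[OF intS, of "space M" "y\<^sup>2"] \<open>0 < y\<close> by simp
  also have "\<dots> \<le> (n * V + (n * (6 * (V / y)))\<^sup>2) / y\<^sup>2"
    using ES by (intro divide_right_mono) auto
  also have "\<dots> = r + 36 * r\<^sup>2"
    using \<open>0 < y\<close> unfolding r by (simp add: field_simps power2_eq_square)
  finally have P1: "\<P>(\<omega> in M. y\<^sup>2 \<le> (S \<omega>)\<^sup>2) \<le> r + 36 * r\<^sup>2" .
  have tail0: "\<P>(\<omega> in M. y < \<bar>Y i \<omega>\<bar>) \<le> 6 * (V / y\<^sup>2)" if "i \<in> I" for i
  proof -
    have "\<P>(\<omega> in M. y < \<bar>Y i \<omega>\<bar>) = measure (distr M borel (Y i)) {u. y < \<bar>u\<bar>}"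
      using Y[OF that] by (subst measure_distr) (auto intro!: arg_cong[where f=prob])
    also have "\<dots> = \<P>(\<omega> in M. y < \<bar>Y0 \<omega>\<bar>)"
      unfolding ident[OF that] by (subst measure_distr) (auto intro!: arg_cong[where f=prob])
    finally show ?thesis using tail_le_truncated_second_moment[OF Y0(1) \<open>0 < y\<close> tail] by simp
  qed
  have "\<P>(\<omega> in M. y < \<bar>\<Sum>i\<in>I. Y i \<omega>\<bar>) \<le> prob ({\<omega> \<in> space M. y\<^sup>2 \<le> (S \<omega>)\<^sup>2} \<union> (\<Union>i\<in>I. {\<omega> \<in> space M. y < \<bar>Y i \<omega>\<bar>}))"
  proof (rule finite_measure_mono)
    show "{\<omega> \<in> space M. y < \<bar>\<Sum>i\<in>I. Y i \<omega>\<bar>} \<subseteq> {\<omega> \<in> space M. y\<^sup>2 \<le> (S \<omega>)\<^sup>2} \<union> (\<Union>i\<in>I. {\<omega> \<in> space M. y < \<bar>Y i \<omega>\<bar>})"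
    proof (safe, rule ccontr)
      fix \<omega> assume *: "y < \<bar>\<Sum>i\<in>I. Y i \<omega>\<bar>" "\<omega> \<notin> (\<Union>i\<in>I. {\<omega> \<in> space M. y < \<bar>Y i \<omega>\<bar>})" "\<omega> \<in> space M"
        "\<not> y\<^sup>2 \<le> (S \<omega>)\<^sup>2"
      then have "S \<omega> = (\<Sum>i\<in>I. Y i \<omega>)"
        unfolding S_def by (intro sum.cong) (auto simp: \<tau>_def)
      then have "\<bar>y\<bar> \<le> \<bar>S \<omega>\<bar>" using * \<open>0 < y\<close> by simp
      with * show False by (simp add: abs_le_square_iff)
    qed
    show "{\<omega> \<in> space M. y\<^sup>2 \<le> (S \<omega>)\<^sup>2} \<union> (\<Union>i\<in>I. {\<omega> \<in> space M. y < \<bar>Y i \<omega>\<bar>}) \<in> events"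
      using \<open>finite I\<close> by (intro sets.Un sets.finite_UN) auto
  qed
  also have "\<dots> \<le> \<P>(\<omega> in M. y\<^sup>2 \<le> (S \<omega>)\<^sup>2) + prob (\<Union>i\<in>I. {\<omega> \<in> space M. y < \<bar>Y i \<omega>\<bar>})"
    using \<open>finite I\<close> by (intro measure_Un_le sets.finite_UN) auto
  also have "prob (\<Union>i\<in>I. {\<omega> \<in> space M. y < \<bar>Y i \<omega>\<bar>}) \<le> (\<Sum>i\<in>I. \<P>(\<omega> in M. y < \<bar>Y i \<omega>\<bar>))"
    using \<open>finite I\<close> by (intro finite_measure_subadditive_finite) auto
  also have "\<dots> \<le> (\<Sum>i\<in>I. 6 * (V / y\<^sup>2))" by (intro sum_mono tail0)
  also have "\<dots> \<le> n * (6 * (V / y\<^sup>2))"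
    using \<open>card I \<le> n\<close> V_nonneg by (simp only: sum_constant) (intro mult_right_mono, auto)
  also have "n * (6 * (V / y\<^sup>2)) = 6 * r" unfolding r by simp
  finally show ?thesis using P1 by simp
qed

section \<open>Conditioning on the other summands\<close>

text \<open>\<open>W\<close> encodes a random target together with an event: it is \<open>None\<close> outside the event. The variable
  \<open>U\<close> is wrapped in \<open>Some\<close> because both arguments of \<open>indep_var\<close> must have the same type.\<close>

lemma (in prob_space) prob_indep_option_eq:
  fixes U :: "'a \<Rightarrow> int" and W :: "'a \<Rightarrow> int option"
  assumes indep: "indep_var (count_space UNIV) (\<lambda>\<omega>. Some (U \<omega>)) (count_space UNIV) W" and "0 \<le> B"
  shows "(\<And>k. Some k \<in> range W \<Longrightarrow> \<P>(\<omega> in M. U \<omega> = k) \<le> B) \<Longrightarrow>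
      \<P>(\<omega> in M. W \<omega> = Some (U \<omega>)) \<le> B * \<P>(\<omega> in M. W \<omega> \<noteq> None)"
    and "(\<And>k. Some k \<in> range W \<Longrightarrow> B \<le> \<P>(\<omega> in M. U \<omega> = k)) \<Longrightarrow>
      B * \<P>(\<omega> in M. W \<omega> \<noteq> None) \<le> \<P>(\<omega> in M. W \<omega> = Some (U \<omega>))"
proof -
  have [measurable]: "(\<lambda>\<omega>. Some (U \<omega>)) \<in> measurable M (count_space UNIV)" "W \<in> measurable M (count_space UNIV)"
    by (rule indep_var_rv1[OF indep], rule indep_var_rv2[OF indep])
  have "(\<lambda>\<omega>. the (Some (U \<omega>))) \<in> measurable M (count_space UNIV)"
    by (rule measurable_compose[OF indep_var_rv1[OF indep]]) simp
  then have [measurable]: "U \<in> measurable M (count_space UNIV)" by simp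
  have some: "emeasure M {\<omega> \<in> space M. W \<omega> \<noteq> None} = (\<integral>\<^sup>+k. emeasure M {\<omega> \<in> space M. W \<omega> = Some k} \<partial>count_space UNIV)"
    by (subst emeasure_UN_countable[symmetric]) (auto simp: disjoint_family_on_def intro!: arg_cong[where f="emeasure M"])
  have "emeasure M {\<omega> \<in> space M. W \<omega> = Some (U \<omega>)} =
      (\<integral>\<^sup>+k. emeasure M {\<omega> \<in> space M. U \<omega> = k \<and> W \<omega> = Some k} \<partial>count_space UNIV)"
    by (subst emeasure_UN_countable[symmetric]) (auto simp: disjoint_family_on_def intro!: arg_cong[where f="emeasure M"])
  also have "\<dots> = (\<integral>\<^sup>+k. ennreal \<P>(\<omega> in M. U \<omega> = k) * emeasure M {\<omega> \<in> space M. W \<omega> = Some k} \<partial>count_space UNIV)"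
  proof (intro nn_integral_cong)
    fix k
    have "(\<lambda>x. (Some (U x), W x)) -` ({Some k} \<times> {Some k}) \<inter> space M = {\<omega> \<in> space M. U \<omega> = k \<and> W \<omega> = Some k}"
      "(\<lambda>\<omega>. Some (U \<omega>)) -` {Some k} \<inter> space M = {\<omega> \<in> space M. U \<omega> = k}" "W -` {Some k} \<inter> space M = {\<omega> \<in> space M. W \<omega> = Some k}" by auto
    then show "emeasure M {\<omega> \<in> space M. U \<omega> = k \<and> W \<omega> = Some k} =
        ennreal \<P>(\<omega> in M. U \<omega> = k) * emeasure M {\<omega> \<in> space M. W \<omega> = Some k}"
      using indep_varD[OF indep, of "{Some k}" "{Some k}"] by (simp add: emeasure_eq_measure ennreal_mult)
  qed
  finally have eq: "emeasure M {\<omega> \<in> space M. W \<omega> = Some (U \<omega>)} =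
    (\<integral>\<^sup>+k. ennreal \<P>(\<omega> in M. U \<omega> = k) * emeasure M {\<omega> \<in> space M. W \<omega> = Some k} \<partial>count_space UNIV)" .
  have scaled: "ennreal B * emeasure M {\<omega> \<in> space M. W \<omega> \<noteq> None} =
    (\<integral>\<^sup>+k. ennreal B * emeasure M {\<omega> \<in> space M. W \<omega> = Some k} \<partial>count_space UNIV)"
    unfolding some by (subst nn_integral_cmult) auto
  \<comment> \<open>The bounds on the law of \<open>U\<close> are assumed at values taken by
    \<open>W\<close> only, so the remaining terms have to vanish.\<close>
  have empty: "emeasure M {\<omega> \<in> space M. W \<omega> = Some k} = 0" if "Some k \<notin> range W" for k
  proof -
    have "{\<omega> \<in> space M. W \<omega> = Some k} = {}" using that by (auto simp: image_iff) (metis)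
    then show ?thesis by (simp only: emeasure_empty)
  qed
  {
    assume *: "\<And>k. Some k \<in> range W \<Longrightarrow> \<P>(\<omega> in M. U \<omega> = k) \<le> B"
    have "ennreal \<P>(\<omega> in M. U \<omega> = k) * emeasure M {\<omega> \<in> space M. W \<omega> = Some k} \<le>
        ennreal B * emeasure M {\<omega> \<in> space M. W \<omega> = Some k}" for k
      using *[of k] empty[of k] by (cases "Some k \<in> range W") (simp_all only: mult_right_mono ennreal_leI zero_le mult_zero_right order_refl simp_thms)
    then have "emeasure M {\<omega> \<in> space M. W \<omega> = Some (U \<omega>)} \<le> ennreal B * emeasure M {\<omega> \<in> space M. W \<omega> \<noteq> None}"
      unfolding eq scaled by (intro nn_integral_mono)
    then show "\<P>(\<omega> in M. W \<omega> = Some (U \<omega>)) \<le> B * \<P>(\<omega> in M. W \<omega> \<noteq> None)"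
      using \<open>0 \<le> B\<close> by (simp add: emeasure_eq_measure flip: ennreal_mult)
  }
  {
    assume *: "\<And>k. Some k \<in> range W \<Longrightarrow> B \<le> \<P>(\<omega> in M. U \<omega> = k)"
    have "ennreal B * emeasure M {\<omega> \<in> space M. W \<omega> = Some k} \<le>
        ennreal \<P>(\<omega> in M. U \<omega> = k) * emeasure M {\<omega> \<in> space M. W \<omega> = Some k}" for k
      using *[of k] empty[of k] by (cases "Some k \<in> range W") (simp_all only: mult_right_mono ennreal_leI zero_le mult_zero_right order_refl simp_thms)
    then have "ennreal B * emeasure M {\<omega> \<in> space M. W \<omega> \<noteq> None} \<le> emeasure M {\<omega> \<in> space M. W \<omega> = Some (U \<omega>)}"
      unfolding eq scaled by (intro nn_integral_mono)
    then show "B * \<P>(\<omega> in M. W \<omega> \<noteq> None) \<le> \<P>(\<omega> in M. W \<omega> = Some (U \<omega>))"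
      using \<open>0 \<le> B\<close> by (simp add: emeasure_eq_measure flip: ennreal_mult)
  }
qed

text \<open>A finite product of the counting spaces on the integers is again a counting space, by
  countability. Hence \<open>g\<close> may be an arbitrary function, and sums and events built from
  the other summands can be encoded in it freely.\<close>

lemma (in prob_space) indep_var_of_rest:
  fixes X :: "'i \<Rightarrow> 'a \<Rightarrow> int" and g :: "('i \<Rightarrow> int) \<Rightarrow> int option"
  assumes indep: "indep_vars (\<lambda>_. count_space UNIV) X I" and "finite I" "i \<in> I"
  shows "indep_var (count_space UNIV) (\<lambda>\<omega>. Some (X i \<omega>)) (count_space UNIV) (\<lambda>\<omega>. g (\<lambda>j\<in>I - {i}. X j \<omega>))"
proof -
  have eq: "PiM J (\<lambda>_. count_space (UNIV :: int set)) = count_space (PiE J (\<lambda>_. UNIV))" if "finite J" for J :: "'i set"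
    using that by (intro count_space_PiM_finite) auto
  have "indep_var (PiM {i} (\<lambda>_. count_space UNIV)) (\<lambda>\<omega>. \<lambda>j\<in>{i}. X j \<omega>)
      (PiM (I - {i}) (\<lambda>_. count_space UNIV)) (\<lambda>\<omega>. \<lambda>j\<in>I - {i}. X j \<omega>)"
    using \<open>i \<in> I\<close> by (intro indep_var_restrict[OF indep]) auto
  then have "indep_var (count_space UNIV) ((\<lambda>z. Some (z i)) \<circ> (\<lambda>\<omega>. \<lambda>j\<in>{i}. X j \<omega>))
      (count_space UNIV) (g \<circ> (\<lambda>\<omega>. \<lambda>j\<in>I - {i}. X j \<omega>))"
    by (rule indep_var_compose) (use \<open>finite I\<close> in \<open>simp_all add: eq\<close>)
  then show ?thesis by (simp add: comp_def)
qed

section \<open>The i.i.d. sequence and the price of one summand\<close>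

locale iid_int_sequence = prob_space M for M :: "'a measure" +
  fixes \<xi> :: "'a \<Rightarrow> int" and X :: "nat \<Rightarrow> 'a \<Rightarrow> int"
  assumes rv_\<xi> [measurable]: "\<xi> \<in> measurable M (count_space UNIV)"
    and iid: "iid_copies M \<xi> X"
begin

definition p :: "int \<Rightarrow> real" where
  "p k = \<P>(\<omega> in M. \<xi> \<omega> = k)"

definition sum_except :: "nat \<Rightarrow> nat \<Rightarrow> 'a \<Rightarrow> int" where
  "sum_except n i \<omega> = (\<Sum>j\<in>{1..n} - {i}. X j \<omega>)"

lemma p_nonneg [simp]: "0 \<le> p k"
  by (simp add: p_def)

lemma indep: "indep_vars (\<lambda>_. count_space UNIV) X {1..n}"
  using iid indep_vars_subset[of "\<lambda>_. count_space UNIV" X "{1..}" "{1..n}"] by (auto simp: iid_copies_def)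

lemma rv_X [measurable]: "i \<ge> 1 \<Longrightarrow> X i \<in> measurable M (count_space UNIV)"
  using iid by (auto simp: iid_copies_def indep_vars_def)

lemma prob_X:
  assumes "i \<ge> 1"
  shows "\<P>(\<omega> in M. X i \<omega> \<in> A) = \<P>(\<omega> in M. \<xi> \<omega> \<in> A)"
proof -
  have "measure (distr M (count_space UNIV) (X i)) A = measure (distr M (count_space UNIV) \<xi>) A"
    using iid assms by (simp add: iid_copies_def)
  moreover have "X i -` A \<inter> space M = {\<omega> \<in> space M. X i \<omega> \<in> A}" "\<xi> -` A \<inter> space M = {\<omega> \<in> space M. \<xi> \<omega> \<in> A}" by auto
  ultimately show ?thesis using assms by (simp add: measure_distr)
qed

lemma prob_X_eq: "i \<ge> 1 \<Longrightarrow> \<P>(\<omega> in M. X i \<omega> = k) = p k"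
  using prob_X[of i "{k}"] by (simp add: p_def)

lemma rv_family [measurable]: "(\<lambda>\<omega>. \<lambda>i\<in>{1..n}. X i \<omega>) \<in> measurable M (count_space (PiE {1..n} (\<lambda>_. UNIV)))"
proof -
  have "(\<lambda>\<omega>. \<lambda>i\<in>{1..n}. X i \<omega>) \<in> measurable M (PiM {1..n} (\<lambda>_. count_space UNIV))"
    by (intro measurable_restrict) auto
  then show ?thesis by (subst (asm) count_space_PiM_finite) auto
qed

text \<open>The first \<open>n\<close> variables jointly take countably many values, so
  measurability is automatic. The premise says that \<open>h\<close> reads the coordinates 1 to
  \<open>n\<close> only, which matters because nothing is known about \<open>X 0\<close>.\<close>

lemma rv_of_family:
  assumes "\<And>z z'. (\<And>i. i \<in> {1..n} \<Longrightarrow> z i = z' i) \<Longrightarrow> h z = h z'"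
  shows "(\<lambda>\<omega>. h (\<lambda>i. X i \<omega>)) \<in> measurable M (count_space UNIV)"
proof -
  have "(\<lambda>\<omega>. h (\<lambda>i\<in>{1..n}. X i \<omega>)) \<in> measurable M (count_space UNIV)"
    by (rule measurable_compose[OF rv_family]) auto
  moreover have "h (\<lambda>i. X i \<omega>) = h (\<lambda>i\<in>{1..n}. X i \<omega>)" for \<omega> by (rule assms) auto
  ultimately show ?thesis by simp
qed

lemma partial_sum_split: "i \<in> {1..n} \<Longrightarrow> partial_sum X n \<omega> = X i \<omega> + sum_except n i \<omega>"
  by (simp add: partial_sum_def sum_except_def sum.remove)

lemma rv_sum_except [measurable]: "sum_except n i \<in> measurable M (count_space UNIV)"
  unfolding sum_except_def by (rule rv_of_family[of n "\<lambda>z. \<Sum>j\<in>{1..n} - {i}. z j"]) (auto intro: sum.cong)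

lemma rv_partial_sum [measurable]: "partial_sum X n \<in> measurable M (count_space UNIV)"
  unfolding partial_sum_def by (rule rv_of_family[of n "\<lambda>z. \<Sum>j=1..n. z j"]) (auto intro: sum.cong)

text \<open>Once the other summands are known, hitting \<open>N\<close> leaves \<open>X i\<close> a
  single admissible value, \<open>N - sum_except n i \<omega>\<close>. \<open>W\<close> records it
  when it lies in \<open>K\<close>, and independence prices it at no more than
  \<open>B\<close>.\<close>

lemma jump_upper:
  assumes i: "i \<in> {1..n}" and B: "0 \<le> B" "\<And>k. k \<in> K \<Longrightarrow> p k \<le> B"
  shows "\<P>(\<omega> in M. X i \<omega> \<in> K \<and> partial_sum X n \<omega> = N \<and> sum_except n i \<omega> \<in> R)
    \<le> B * \<P>(\<omega> in M. sum_except n i \<omega> \<in> R)"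
proof -
  define g where "g z = (let t = (\<Sum>j\<in>{1..n} - {i}. z j) in if t \<in> R \<and> N - t \<in> K then Some (N - t) else None)"
    for z :: "nat \<Rightarrow> int"
  define W where "W \<omega> = g (\<lambda>j\<in>{1..n} - {i}. X j \<omega>)" for \<omega>
  have W: "W \<omega> = (if sum_except n i \<omega> \<in> R \<and> N - sum_except n i \<omega> \<in> K then Some (N - sum_except n i \<omega>) else None)" for \<omega>
    by (simp add: W_def g_def sum_except_def Let_def)
  have ind: "indep_var (count_space UNIV) (\<lambda>\<omega>. Some (X i \<omega>)) (count_space UNIV) W"
    unfolding W_def by (rule indep_var_of_rest[OF indep _ i]) auto
  have "X i \<omega> \<in> K \<and> partial_sum X n \<omega> = N \<and> sum_except n i \<omega> \<in> R \<longleftrightarrow> W \<omega> = Some (X i \<omega>)" for \<omega>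
    by (auto simp: W partial_sum_split[OF i])
  then have "\<P>(\<omega> in M. X i \<omega> \<in> K \<and> partial_sum X n \<omega> = N \<and> sum_except n i \<omega> \<in> R) = \<P>(\<omega> in M. W \<omega> = Some (X i \<omega>))"
    by simp
  also have "\<dots> \<le> B * \<P>(\<omega> in M. W \<omega> \<noteq> None)"
  proof (rule prob_indep_option_eq(1)[OF ind B(1)])
    fix k assume "Some k \<in> range W"
    then have "k \<in> K" by (auto simp: W split: if_splits)
    then show "\<P>(\<omega> in M. X i \<omega> = k) \<le> B" using B(2) i by (simp add: prob_X_eq)
  qed
  also have "\<dots> \<le> B * \<P>(\<omega> in M. sum_except n i \<omega> \<in> R)"
    by (intro mult_left_mono B finite_measure_mono) (auto simp: W)
  finally show ?thesis .
qed

text \<open>The same conditioning, with the other summands also kept out of \<open>J\<close>. This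
  extra restriction makes the events for different \<open>i\<close> disjoint, so that lower bounds
  can be added.\<close>

lemma jump_lower:
  assumes i: "i \<in> {1..n}" and L: "0 \<le> L" "\<And>k. k \<in> J \<Longrightarrow> L \<le> p k" and R: "\<And>t. t \<in> R \<Longrightarrow> N - t \<in> J"
  shows "L * \<P>(\<omega> in M. sum_except n i \<omega> \<in> R \<and> (\<forall>j\<in>{1..n} - {i}. X j \<omega> \<notin> J))
    \<le> \<P>(\<omega> in M. X i \<omega> \<in> J \<and> partial_sum X n \<omega> = N \<and> (\<forall>j\<in>{1..n} - {i}. X j \<omega> \<notin> J))"
proof -
  define g where "g z = (let t = (\<Sum>j\<in>{1..n} - {i}. z j) in
      if t \<in> R \<and> (\<forall>j\<in>{1..n} - {i}. z j \<notin> J) then Some (N - t) else None)" for z :: "nat \<Rightarrow> int"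
  define W where "W \<omega> = g (\<lambda>j\<in>{1..n} - {i}. X j \<omega>)" for \<omega>
  have W: "W \<omega> = (if sum_except n i \<omega> \<in> R \<and> (\<forall>j\<in>{1..n} - {i}. X j \<omega> \<notin> J) then Some (N - sum_except n i \<omega>) else None)" for \<omega>
    by (simp add: W_def g_def sum_except_def Let_def)
  have ind: "indep_var (count_space UNIV) (\<lambda>\<omega>. Some (X i \<omega>)) (count_space UNIV) W"
    unfolding W_def by (rule indep_var_of_rest[OF indep _ i]) auto
  have "L * \<P>(\<omega> in M. sum_except n i \<omega> \<in> R \<and> (\<forall>j\<in>{1..n} - {i}. X j \<omega> \<notin> J)) = L * \<P>(\<omega> in M. W \<omega> \<noteq> None)"
    by (intro arg_cong[where f="\<lambda>A. L * prob A"]) (auto simp: W)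
  also have "\<dots> \<le> \<P>(\<omega> in M. W \<omega> = Some (X i \<omega>))"
  proof (rule prob_indep_option_eq(2)[OF ind L(1)])
    fix k assume "Some k \<in> range W"
    then have "k \<in> J" using R by (auto simp: W split: if_splits)
    then show "L \<le> \<P>(\<omega> in M. X i \<omega> = k)" using L(2) i by (simp add: prob_X_eq)
  qed
  also have "\<dots> \<le> \<P>(\<omega> in M. X i \<omega> \<in> J \<and> partial_sum X n \<omega> = N \<and> (\<forall>j\<in>{1..n} - {i}. X j \<omega> \<notin> J))"
  proof (rule finite_measure_mono)
    show "{\<omega> \<in> space M. X i \<omega> \<in> J \<and> partial_sum X n \<omega> = N \<and> (\<forall>j\<in>{1..n} - {i}. X j \<omega> \<notin> J)} \<in> events"
    proof -
      have [measurable]: "X i \<in> measurable M (count_space UNIV)" using i by simp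
      have [measurable]: "Measurable.pred M (\<lambda>\<omega>. \<forall>j\<in>{1..n} - {i}. X j \<omega> \<notin> J)"
        by (rule rv_of_family[of n "\<lambda>z. \<forall>j\<in>{1..n} - {i}. z j \<notin> J"]) auto
      show ?thesis by measurable
    qed
  qed (auto simp: W partial_sum_split[OF i] split: if_splits dest: R)
  finally show ?thesis .
qed

lemma partial_max_greater_iff:
  assumes "n \<ge> 1"
  shows "v < real_of_int (partial_max X n \<omega>) \<longleftrightarrow> (\<exists>i\<in>{1..n}. v < real_of_int (X i \<omega>))"
proof -
  have "partial_max X n \<omega> \<in> (\<lambda>i. X i \<omega>) ` {1..n}"
    unfolding partial_max_def using assms by (intro Max_in) auto
  moreover have "X i \<omega> \<le> partial_max X n \<omega>" if "i \<in> {1..n}" for i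
    unfolding partial_max_def using that by (intro Max_ge) auto
  ultimately show ?thesis by (fastforce simp: less_le_trans)
qed

lemma rv_partial_max [measurable]:
  assumes "n \<ge> 1"
  shows "(\<lambda>\<omega>. real_of_int (partial_max X n \<omega>)) \<in> borel_measurable M"
  by (subst borel_measurable_iff_greater) (auto simp: partial_max_greater_iff[OF assms])

end

section \<open>The probability of one big jump\<close>

text \<open>The interface between analysis and probability. The 1 in \<open>target\<close> is the
  rounding error of the floor. The bounds in \<open>deviation\<close> are uniform in
  \<open>i\<close> because \<open>n\<close> of them are added and the result is divided by
  \<open>n\<close>. Its first half is the weak law for the other summands; its second half makes a
  second large summand negligible by a union bound.\<close>

locale one_big_jump = iid_int_sequence M \<xi> X for M :: "'a measure" and \<xi> X +
  fixes x N :: "nat \<Rightarrow> int" and \<mu> :: real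
  assumes target: "\<And>n. \<bar>real_of_int (N n) - real_of_int (x n) - real n * \<mu>\<bar> \<le> 1"
    and x_at_top: "filterlim (\<lambda>n. real_of_int (x n)) at_top sequentially"
    and deviation: "\<And>c. c > 0 \<Longrightarrow> \<exists>\<rho>. \<rho> \<longlonglongrightarrow> 0 \<and> (\<forall>\<^sub>F n in sequentially.
      (\<forall>i\<in>{1..n}. \<P>(\<omega> in M. c * real_of_int (x n) < \<bar>real_of_int (sum_except n i \<omega>) - (real n - 1) * \<mu>\<bar>) \<le> \<rho> n) \<and>
      real n * \<P>(\<omega> in M. c * real_of_int (x n) < \<bar>real_of_int (\<xi> \<omega>) - \<mu>\<bar>) \<le> \<rho> n)"
    and uniform: "\<And>d. d > 0 \<Longrightarrow> \<exists>r>1::real. \<exists>T>0. \<forall>y\<ge>T. \<forall>w\<ge>T. y / r \<le> w \<and> w \<le> r * y \<longrightarrow>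
      0 < p \<lfloor>y\<rfloor> \<and> p \<lfloor>w\<rfloor> \<le> exp d * p \<lfloor>y\<rfloor>"
    and dominated: "\<And>c::real. c > 0 \<Longrightarrow> \<exists>C>0. \<exists>T>0. \<forall>y\<ge>T. \<forall>w\<ge>c * y. p \<lfloor>w\<rfloor> \<le> C * p \<lfloor>y\<rfloor>"
begin

definition big_max_prob :: "real \<Rightarrow> nat \<Rightarrow> real" where
  "big_max_prob z n = \<P>(\<omega> in M. z * real_of_int (x n) < real_of_int (partial_max X n \<omega>) \<and> partial_sum X n \<omega> = N n)"

lemma uniformE:
  assumes "d > 0"
  obtains r T :: real where "r > 1" "T > 0"
    "\<And>y w. T \<le> y \<Longrightarrow> T \<le> w \<Longrightarrow> y / r \<le> w \<Longrightarrow> w \<le> r * y \<Longrightarrow> 0 < p \<lfloor>y\<rfloor>"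
    "\<And>y w. T \<le> y \<Longrightarrow> T \<le> w \<Longrightarrow> y / r \<le> w \<Longrightarrow> w \<le> r * y \<Longrightarrow> p \<lfloor>w\<rfloor> \<le> exp d * p \<lfloor>y\<rfloor>"
proof -
  obtain r T :: real where "r > 1" "T > 0" and
    *: "\<forall>y\<ge>T. \<forall>w\<ge>T. y / r \<le> w \<and> w \<le> r * y \<longrightarrow> 0 < p \<lfloor>y\<rfloor> \<and> p \<lfloor>w\<rfloor> \<le> exp d * p \<lfloor>y\<rfloor>"
    using uniform[OF assms] by blast
  then show thesis by (intro that[of r T]) auto
qed

lemma deviationE:
  assumes "c > 0"
  obtains \<rho> where "\<rho> \<longlonglongrightarrow> 0"
    "\<forall>\<^sub>F n in sequentially. \<forall>i\<in>{1..n}.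
      \<P>(\<omega> in M. c * real_of_int (x n) < \<bar>real_of_int (sum_except n i \<omega>) - (real n - 1) * \<mu>\<bar>) \<le> \<rho> n"
    "\<forall>\<^sub>F n in sequentially. real n * \<P>(\<omega> in M. c * real_of_int (x n) < \<bar>real_of_int (\<xi> \<omega>) - \<mu>\<bar>) \<le> \<rho> n"
  using deviation[OF assms] unfolding eventually_conj_iff by blast

lemma p_x_pos: "\<forall>\<^sub>F n in sequentially. 0 < p (x n)"
proof -
  obtain r T :: real where r: "r > 1" and T: "T > 0" "\<And>y w. T \<le> y \<Longrightarrow> T \<le> w \<Longrightarrow> y / r \<le> w \<Longrightarrow> w \<le> r * y \<Longrightarrow> 0 < p \<lfloor>y\<rfloor>"
    by (rule uniformE[of 1]) auto
  have "\<forall>\<^sub>F n in sequentially. T \<le> real_of_int (x n)" using x_at_top by (simp add: filterlim_at_top)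
  then show ?thesis
  proof eventually_elim
    case (elim n)
    have "1 * real_of_int (x n) \<le> r * real_of_int (x n)" using r T(1) elim by (intro mult_right_mono) auto
    then show ?case using T(2)[of "real_of_int (x n)" "real_of_int (x n)"] elim r by (simp add: pos_divide_le_eq mult.commute)
  qed
qed

lemma eventually_x_ge: "c > 0 \<Longrightarrow> \<forall>\<^sub>F n in sequentially. v \<le> c * real_of_int (x n)"
proof -
  assume "c > 0"
  have "\<forall>\<^sub>F n in sequentially. v / c \<le> real_of_int (x n)" using x_at_top by (simp add: filterlim_at_top)
  then show ?thesis by eventually_elim (use \<open>c > 0\<close> in \<open>simp add: pos_divide_le_eq mult.commute\<close>)
qed

lemma big_max_prob_le_sum:
  assumes "n \<ge> 1"
  shows "big_max_prob z n \<le> (\<Sum>i\<in>{1..n}. \<P>(\<omega> in M. z * real_of_int (x n) < real_of_int (X i \<omega>) \<and> partial_sum X n \<omega> = N n))"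
proof -
  have "big_max_prob z n = prob (\<Union>i\<in>{1..n}. {\<omega> \<in> space M. z * real_of_int (x n) < real_of_int (X i \<omega>) \<and> partial_sum X n \<omega> = N n})"
    unfolding big_max_prob_def by (intro arg_cong[where f=prob]) (auto simp: partial_max_greater_iff[OF assms])
  also have "\<dots> \<le> (\<Sum>i\<in>{1..n}. \<P>(\<omega> in M. z * real_of_int (x n) < real_of_int (X i \<omega>) \<and> partial_sum X n \<omega> = N n))"
    by (intro finite_measure_subadditive_finite) auto
  finally show ?thesis .
qed

lemma far_from_target_le:
  assumes "c > 0" "z > 0"
  shows "\<exists>\<rho>. \<rho> \<longlonglongrightarrow> 0 \<and> (\<forall>\<^sub>F n in sequentially. \<forall>i\<in>{1..n}. \<P>(\<omega> in M. X i \<omega> \<in> {k. z * real_of_int (x n) < real_of_int k} \<and>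
    partial_sum X n \<omega> = N n \<and> sum_except n i \<omega> \<in> {t. c * real_of_int (x n) < \<bar>real_of_int t - (real n - 1) * \<mu>\<bar>}) \<le> \<rho> n * p (x n))"
proof -
  obtain C T where C: "C > 0" and T: "\<And>y w. T \<le> y \<Longrightarrow> z * y \<le> w \<Longrightarrow> p \<lfloor>w\<rfloor> \<le> C * p \<lfloor>y\<rfloor>"
    using dominated[OF \<open>z > 0\<close>] by auto
  obtain \<rho> where \<rho>: "\<rho> \<longlonglongrightarrow> 0" and dev: "\<forall>\<^sub>F n in sequentially.
      \<forall>i\<in>{1..n}. \<P>(\<omega> in M. c * real_of_int (x n) < \<bar>real_of_int (sum_except n i \<omega>) - (real n - 1) * \<mu>\<bar>) \<le> \<rho> n"
    by (rule deviationE[OF \<open>c > 0\<close>])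
  show ?thesis
  proof (rule exI[of _ "\<lambda>n. C * \<rho> n"], intro conjI)
    show "(\<lambda>n. C * \<rho> n) \<longlonglongrightarrow> 0" using tendsto_mult_right_zero[OF \<rho>] .
    have "\<forall>\<^sub>F n in sequentially. T \<le> real_of_int (x n)" using x_at_top by (simp add: filterlim_at_top)
    then show "\<forall>\<^sub>F n in sequentially. \<forall>i\<in>{1..n}. \<P>(\<omega> in M. X i \<omega> \<in> {k. z * real_of_int (x n) < real_of_int k} \<and>
      partial_sum X n \<omega> = N n \<and> sum_except n i \<omega> \<in> {t. c * real_of_int (x n) < \<bar>real_of_int t - (real n - 1) * \<mu>\<bar>}) \<le> C * \<rho> n * p (x n)"
      using dev
    proof eventually_elim
      case (elim n)
      show ?case
      proof
        fix i assume i: "i \<in> {1..n}"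
        have "\<P>(\<omega> in M. X i \<omega> \<in> {k. z * real_of_int (x n) < real_of_int k} \<and>
            partial_sum X n \<omega> = N n \<and> sum_except n i \<omega> \<in> {t. c * real_of_int (x n) < \<bar>real_of_int t - (real n - 1) * \<mu>\<bar>})
          \<le> C * p (x n) * \<P>(\<omega> in M. sum_except n i \<omega> \<in> {t. c * real_of_int (x n) < \<bar>real_of_int t - (real n - 1) * \<mu>\<bar>})"
          using i C T[of "x n" "real_of_int _"] elim by (intro jump_upper) auto
        also have "\<dots> \<le> C * p (x n) * \<rho> n"
          using elim i C by (intro mult_left_mono) auto
        finally show "\<P>(\<omega> in M. X i \<omega> \<in> {k. z * real_of_int (x n) < real_of_int k} \<and>
            partial_sum X n \<omega> = N n \<and> sum_except n i \<omega> \<in> {t. c * real_of_int (x n) < \<bar>real_of_int t - (real n - 1) * \<mu>\<bar>})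
          \<le> C * \<rho> n * p (x n)" by (simp add: mult_ac)
      qed
    qed
  qed
qed

section \<open>Asymptotics of the big-maximum probability\<close>

lemma big_max_prob_beyond:
  assumes "z > 1"
  shows "(\<lambda>n. big_max_prob z n / (real n * p (x n))) \<longlonglongrightarrow> 0"
proof -
  \<comment> \<open>A summand above \<open>z * x n\<close> forces the others below their mean by
    about \<open>(z - 1) * x n\<close>, that is \<open>2 * c * x n\<close>. Giving up half of this
    for rounding still leaves a deviation of \<open>c * x n\<close>, so the whole event falls under
    \<open>far_from_target_le\<close>.\<close>
  define c where "c = (z - 1) / 2"
  have c: "c > 0" "z > 0" using assms by (auto simp: c_def)
  obtain \<rho> where \<rho>: "\<rho> \<longlonglongrightarrow> 0" and far: "\<forall>\<^sub>F n in sequentially. \<forall>i\<in>{1..n}. \<P>(\<omega> in M. X i \<omega> \<in> {k. z * real_of_int (x n) < real_of_int k} \<and>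
    partial_sum X n \<omega> = N n \<and> sum_except n i \<omega> \<in> {t. c * real_of_int (x n) < \<bar>real_of_int t - (real n - 1) * \<mu>\<bar>}) \<le> \<rho> n * p (x n)"
    using far_from_target_le[OF c] by auto
  have "\<forall>\<^sub>F n in sequentially. norm (big_max_prob z n / (real n * p (x n))) \<le> \<rho> n"
    \<comment> \<open>\<open>\<bar>\<mu>\<bar> + 1\<close> covers the difference between
      \<open>n * \<mu>\<close> and \<open>(n - 1) * \<mu>\<close> and the rounding error in
      \<open>N n\<close>.\<close>
    using far eventually_x_ge[OF c(1), of "\<bar>\<mu>\<bar> + 1"] eventually_ge_at_top[of 1] p_x_pos
  proof eventually_elim
    case (elim n)
    have "big_max_prob z n \<le> (\<Sum>i\<in>{1..n}. \<P>(\<omega> in M. z * real_of_int (x n) < real_of_int (X i \<omega>) \<and> partial_sum X n \<omega> = N n))"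
      by (rule big_max_prob_le_sum[OF elim(3)])
    also have "\<dots> \<le> (\<Sum>i\<in>{1..n}. \<rho> n * p (x n))"
    proof (rule sum_mono)
      fix i assume i: "i \<in> {1..n}"
      have "\<P>(\<omega> in M. z * real_of_int (x n) < real_of_int (X i \<omega>) \<and> partial_sum X n \<omega> = N n) =
        \<P>(\<omega> in M. X i \<omega> \<in> {k. z * real_of_int (x n) < real_of_int k} \<and>
          partial_sum X n \<omega> = N n \<and> sum_except n i \<omega> \<in> {t. c * real_of_int (x n) < \<bar>real_of_int t - (real n - 1) * \<mu>\<bar>})"
      proof (rule arg_cong[where f=prob], rule Collect_cong, rule conj_cong, rule refl)
        fix \<omega>
        have "c * real_of_int (x n) < \<bar>real_of_int (sum_except n i \<omega>) - (real n - 1) * \<mu>\<bar>"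
          if "z * real_of_int (x n) < real_of_int (X i \<omega>)" "partial_sum X n \<omega> = N n"
        proof -
          have "real_of_int (N n) = real_of_int (X i \<omega>) + real_of_int (sum_except n i \<omega>)"
            using partial_sum_split[OF i, of \<omega>] that by simp
          moreover have "z * real_of_int (x n) = x n + 2 * (c * real_of_int (x n))" by (simp add: c_def field_simps)
          ultimately show ?thesis using that target[of n] elim(2) by (simp add: algebra_simps)
        qed
        then show "(z * real_of_int (x n) < real_of_int (X i \<omega>) \<and> partial_sum X n \<omega> = N n) = (X i \<omega> \<in> {k. z * real_of_int (x n) < real_of_int k} \<and>
          partial_sum X n \<omega> = N n \<and> sum_except n i \<omega> \<in> {t. c * real_of_int (x n) < \<bar>real_of_int t - (real n - 1) * \<mu>\<bar>})" by auto
      qed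
      then show "\<P>(\<omega> in M. z * real_of_int (x n) < real_of_int (X i \<omega>) \<and> partial_sum X n \<omega> = N n) \<le> \<rho> n * p (x n)"
        using elim(1) i by simp
    qed
    also have "\<dots> = \<rho> n * (real n * p (x n))" by simp
    finally show ?case using elim by (simp add: big_max_prob_def pos_divide_le_eq)
  qed
  then show ?thesis by (rule Lim_null_comparison[OF _ \<rho>])
qed

text \<open>The window has radius \<open>2 * c * x n\<close>: one \<open>c * x n\<close> for the
  deviation of the other summands, one for rounding. It fits between \<open>x n / r\<close> and
  \<open>r * x n\<close>, the lower end being the binding one as
  \<open>1 - 1 / r \<le> r - 1\<close>. The cap \<open>c0\<close> lets a caller narrow the window
  further.\<close>

lemma near_target:
  assumes "d > 0" "c0 > 0"
  obtains c where "c > 0" "c \<le> c0"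
    "\<forall>\<^sub>F n in sequentially. \<forall>k. \<bar>real_of_int k - x n\<bar> \<le> 2 * c * real_of_int (x n) \<longrightarrow>
      p k \<le> exp d * p (x n) \<and> exp (- d) * p (x n) \<le> p k"
proof -
  obtain r T :: real where r: "r > 1" and T: "T > 0" "\<And>y w. T \<le> y \<Longrightarrow> T \<le> w \<Longrightarrow> y / r \<le> w \<Longrightarrow> w \<le> r * y \<Longrightarrow> p \<lfloor>w\<rfloor> \<le> exp d * p \<lfloor>y\<rfloor>"
    by (rule uniformE[OF \<open>d > 0\<close>]) auto
  define c where "c = min ((1 - 1 / r) / 2) c0"
  have c: "c > 0" "c \<le> c0" "2 * c \<le> 1 - 1 / r" using r assms by (auto simp: c_def min_def)
  have r_inv: "0 < 1 / r" using r by simp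
  have r': "1 - 1 / r \<le> r - 1"
  proof -
    have "0 \<le> (r - 1)\<^sup>2 / r" using r by simp
    also have "(r - 1)\<^sup>2 / r = r - 1 - (1 - 1 / r)" using r by (simp add: field_simps power2_eq_square)
    finally show ?thesis by simp
  qed
  have "\<forall>\<^sub>F n in sequentially. \<forall>k. \<bar>real_of_int k - x n\<bar> \<le> 2 * c * real_of_int (x n) \<longrightarrow>
    p k \<le> exp d * p (x n) \<and> exp (- d) * p (x n) \<le> p k"
    using eventually_x_ge[OF r_inv, of T]
  proof eventually_elim
    case (elim n)
    show ?case
    proof (intro allI impI)
      fix k assume k: "\<bar>real_of_int k - x n\<bar> \<le> 2 * c * real_of_int (x n)"
      have "0 < x n / r" using elim r T(1) by simp
      then have xp: "0 < real_of_int (x n)" using r by (simp add: zero_less_divide_iff)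
      have "2 * c * real_of_int (x n) \<le> (1 - 1 / r) * real_of_int (x n)" "2 * c * real_of_int (x n) \<le> (r - 1) * real_of_int (x n)"
        using c r' xp by (intro mult_right_mono; simp)+
      then have k1: "x n / r \<le> real_of_int k" "real_of_int k \<le> r * real_of_int (x n)" using k by (auto simp: algebra_simps)
      then have k2: "real_of_int k / r \<le> x n" "x n \<le> r * real_of_int k" using r by (auto simp: field_simps)
      have xr: "x n / r \<le> x n" using xp r by (simp add: pos_divide_le_eq)
      have ge: "T \<le> x n / r" using elim r by simp
      have "p k \<le> exp d * p (x n)" "p (x n) \<le> exp d * p k"
        using T(2)[of "real_of_int (x n)" "real_of_int k"] T(2)[of "real_of_int k" "real_of_int (x n)"] k1 k2 ge xr by auto
      then show "p k \<le> exp d * p (x n) \<and> exp (- d) * p (x n) \<le> p k"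
        by (simp add: exp_minus field_simps)
    qed
  qed
  then show thesis by (rule that[OF c(1,2)])
qed

lemma big_max_prob_upper:
  assumes "z > 0" "d > 0"
  shows "\<exists>\<rho>. \<rho> \<longlonglongrightarrow> 0 \<and> (\<forall>\<^sub>F n in sequentially. big_max_prob z n / (real n * p (x n)) \<le> exp d + \<rho> n)"
proof -
  obtain c where c: "c > 0" and near: "\<forall>\<^sub>F n in sequentially. \<forall>k. \<bar>real_of_int k - x n\<bar> \<le> 2 * c * real_of_int (x n) \<longrightarrow>
    p k \<le> exp d * p (x n) \<and> exp (- d) * p (x n) \<le> p k"
    by (rule near_target[OF \<open>d > 0\<close>, of 1]) auto
  obtain \<rho> where \<rho>: "\<rho> \<longlonglongrightarrow> 0" and far: "\<forall>\<^sub>F n in sequentially. \<forall>i\<in>{1..n}. \<P>(\<omega> in M. X i \<omega> \<in> {k. z * real_of_int (x n) < real_of_int k} \<and>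
    partial_sum X n \<omega> = N n \<and> sum_except n i \<omega> \<in> {t. c * real_of_int (x n) < \<bar>real_of_int t - (real n - 1) * \<mu>\<bar>}) \<le> \<rho> n * p (x n)"
    using far_from_target_le[OF c \<open>z > 0\<close>] by auto
  have "\<forall>\<^sub>F n in sequentially. big_max_prob z n / (real n * p (x n)) \<le> exp d + \<rho> n"
    using far near eventually_x_ge[OF c, of "\<bar>\<mu>\<bar> + 1"] eventually_ge_at_top[of 1] p_x_pos
  proof eventually_elim
    case (elim n)
    have "big_max_prob z n \<le> (\<Sum>i\<in>{1..n}. \<P>(\<omega> in M. z * real_of_int (x n) < real_of_int (X i \<omega>) \<and> partial_sum X n \<omega> = N n))"
      by (rule big_max_prob_le_sum[OF elim(4)])
    also have "\<dots> \<le> (\<Sum>i\<in>{1..n}. exp d * p (x n) + \<rho> n * p (x n))"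
    proof (rule sum_mono)
      fix i assume i: "i \<in> {1..n}"
      then have [measurable]: "X i \<in> measurable M (count_space UNIV)" by simp
      let ?R = "{t. c * real_of_int (x n) < \<bar>real_of_int t - (real n - 1) * \<mu>\<bar>}"
      let ?J = "{k. \<bar>real_of_int k - x n\<bar> \<le> 2 * c * real_of_int (x n)}"
      let ?E1 = "{\<omega> \<in> space M. X i \<omega> \<in> ?J \<and> partial_sum X n \<omega> = N n \<and> sum_except n i \<omega> \<in> - ?R}"
      let ?E2 = "{\<omega> \<in> space M. X i \<omega> \<in> {k. z * real_of_int (x n) < real_of_int k} \<and> partial_sum X n \<omega> = N n \<and> sum_except n i \<omega> \<in> ?R}"
      have "\<P>(\<omega> in M. z * real_of_int (x n) < real_of_int (X i \<omega>) \<and> partial_sum X n \<omega> = N n) \<le> prob (?E1 \<union> ?E2)"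
      proof (rule finite_measure_mono)
        show "{\<omega> \<in> space M. z * real_of_int (x n) < real_of_int (X i \<omega>) \<and> partial_sum X n \<omega> = N n} \<subseteq> ?E1 \<union> ?E2"
        proof
          fix \<omega> assume w: "\<omega> \<in> {\<omega> \<in> space M. z * real_of_int (x n) < real_of_int (X i \<omega>) \<and> partial_sum X n \<omega> = N n}"
          \<comment> \<open>When the other summands are near their mean, the target alone puts
            \<open>X i\<close> into the window, whatever \<open>z\<close> is.\<close>
          have "\<bar>real_of_int (X i \<omega>) - x n\<bar> \<le> 2 * c * real_of_int (x n)" if "\<bar>real_of_int (sum_except n i \<omega>) - (real n - 1) * \<mu>\<bar> \<le> c * real_of_int (x n)"
          proof -
            have "real_of_int (N n) = real_of_int (X i \<omega>) + real_of_int (sum_except n i \<omega>)"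
              using partial_sum_split[OF i, of \<omega>] w by simp
            then show ?thesis using that target[of n] elim(3) by (simp add: algebra_simps)
          qed
          then show "\<omega> \<in> ?E1 \<union> ?E2" using w by auto
        qed
      qed measurable
      also have "\<dots> \<le> prob ?E1 + prob ?E2" by (intro measure_Un_le) measurable
      also have "prob ?E1 \<le> exp d * p (x n) * \<P>(\<omega> in M. sum_except n i \<omega> \<in> - ?R)"
        using elim(2) by (intro jump_upper i) auto
      also have "\<dots> \<le> exp d * p (x n) * 1" by (intro mult_left_mono) auto
      also have "prob ?E2 \<le> \<rho> n * p (x n)" using elim(1) i by blast
      finally show "\<P>(\<omega> in M. z * real_of_int (x n) < real_of_int (X i \<omega>) \<and> partial_sum X n \<omega> = N n) \<le> exp d * p (x n) + \<rho> n * p (x n)" by simp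
    qed
    also have "\<dots> = (exp d + \<rho> n) * (real n * p (x n))" by (simp add: algebra_simps)
    finally show ?case using elim by (simp add: pos_divide_le_eq)
  qed
  with \<rho> show ?thesis by blast
qed

text \<open>A union bound gives nothing from below, hence the requirement that only one summand lies
  near \<open>x n\<close>. It costs at most \<open>\<rho>2 n\<close>, and \<open>\<rho>1 n\<close>
  pays for the deviation of the other summands. The cap \<open>(1 - z) / 4\<close> on
  \<open>c\<close> places the window above \<open>(1 + z) / 2 * x n\<close>, hence above both
  \<open>z * x n\<close> and half of \<open>x n\<close>.\<close>

lemma big_max_prob_lower:
  assumes "0 < z" "z < 1" "d > 0"
  shows "\<exists>\<rho>. \<rho> \<longlonglongrightarrow> 0 \<and> (\<forall>\<^sub>F n in sequentially. exp (- d) * (1 - \<rho> n) \<le> big_max_prob z n / (real n * p (x n)))"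
proof -
  obtain c where c: "c > 0" "c \<le> (1 - z) / 4" and near: "\<forall>\<^sub>F n in sequentially. \<forall>k. \<bar>real_of_int k - x n\<bar> \<le> 2 * c * real_of_int (x n) \<longrightarrow>
    p k \<le> exp d * p (x n) \<and> exp (- d) * p (x n) \<le> p k"
    by (rule near_target[OF \<open>d > 0\<close>, of "(1 - z) / 4"]) (use assms in auto)
  obtain \<rho>1 where \<rho>1: "\<rho>1 \<longlonglongrightarrow> 0" and dev1: "\<forall>\<^sub>F n in sequentially.
      \<forall>i\<in>{1..n}. \<P>(\<omega> in M. c * real_of_int (x n) < \<bar>real_of_int (sum_except n i \<omega>) - (real n - 1) * \<mu>\<bar>) \<le> \<rho>1 n"
    by (rule deviationE[OF c(1)])
  \<comment> \<open>A value in the window is at least half of \<open>x n\<close>; subtracting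
    \<open>\<mu>\<close>, eventually less than a quarter of \<open>x n\<close>, leaves a deviation
    above a quarter.\<close>
  obtain \<rho>2 where \<rho>2: "\<rho>2 \<longlonglongrightarrow> 0" and dev2: "\<forall>\<^sub>F n in sequentially.
      real n * \<P>(\<omega> in M. 1 / 4 * real_of_int (x n) < \<bar>real_of_int (\<xi> \<omega>) - \<mu>\<bar>) \<le> \<rho>2 n"
    by (rule deviationE[of "1 / 4"]) simp
  have "\<forall>\<^sub>F n in sequentially. exp (- d) * (1 - (\<rho>1 n + \<rho>2 n)) \<le> big_max_prob z n / (real n * p (x n))"
    using dev1 dev2 near eventually_x_ge[OF c(1), of "\<bar>\<mu>\<bar> + 1"] eventually_ge_at_top[of 1] p_x_pos
      eventually_x_ge[of "1 / 4" "\<bar>\<mu>\<bar> + 1", simplified]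
  proof eventually_elim
    case (elim n)
    let ?R = "{t. \<bar>real_of_int t - (real n - 1) * \<mu>\<bar> \<le> c * real_of_int (x n)}"
    let ?J = "{k. \<bar>real_of_int k - x n\<bar> \<le> 2 * c * real_of_int (x n)}"
    \<comment> \<open>Exactly one summand lands near \<open>x n\<close>: these events are disjoint, so their probabilities add up.\<close>
    let ?F = "\<lambda>i. {\<omega> \<in> space M. X i \<omega> \<in> ?J \<and> partial_sum X n \<omega> = N n \<and> (\<forall>j\<in>{1..n} - {i}. X j \<omega> \<notin> ?J)}"
    have xp: "0 < real_of_int (x n)" using elim(7) by linarith
    have cx: "2 * c * real_of_int (x n) \<le> (1 - z) / 2 * real_of_int (x n)" using c xp by (intro mult_right_mono) auto
    have zx: "z * real_of_int (x n) < x n" "0 < z * real_of_int (x n)" using assms xp by auto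
    have J_big: "z * real_of_int (x n) < real_of_int k" "1 / 2 * real_of_int (x n) \<le> real_of_int k" if "k \<in> ?J" for k
      using that cx zx mult_pos_pos[OF c(1) xp] by (auto simp: algebra_simps abs_le_iff)
    have pred_J [measurable]: "Measurable.pred M (\<lambda>\<omega>. \<forall>j\<in>{1..n} - {i}. X j \<omega> \<notin> ?J)" for i
      by (rule rv_of_family[of n "\<lambda>z. \<forall>j\<in>{1..n} - {i}. z j \<notin> ?J"]) auto
    have F_events: "?F i \<in> events" if "i \<in> {1..n}" for i
    proof -
      have [measurable]: "X i \<in> measurable M (count_space UNIV)" using that by simp
      show ?thesis by measurable
    qed
    have F_ge: "exp (- d) * p (x n) * (1 - (\<rho>1 n + \<rho>2 n)) \<le> prob (?F i)" if i: "i \<in> {1..n}" for i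
    proof -
      let ?G = "{\<omega> \<in> space M. sum_except n i \<omega> \<in> ?R \<and> (\<forall>j\<in>{1..n} - {i}. X j \<omega> \<notin> ?J)}"
      let ?B = "{\<omega> \<in> space M. c * real_of_int (x n) < \<bar>real_of_int (sum_except n i \<omega>) - (real n - 1) * \<mu>\<bar>}"
      let ?C = "\<lambda>j. {\<omega> \<in> space M. X j \<omega> \<in> ?J}"
      have C_events: "?C j \<in> events" if "j \<in> {1..n} - {i}" for j
      proof -
        have [measurable]: "X j \<in> measurable M (count_space UNIV)" using that by simp
        show ?thesis by measurable
      qed
      have C_le: "prob (?C j) \<le> \<P>(\<omega> in M. 1 / 4 * real_of_int (x n) < \<bar>real_of_int (\<xi> \<omega>) - \<mu>\<bar>)" if "j \<in> {1..n} - {i}" for j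
      proof -
        have "prob (?C j) = \<P>(\<omega> in M. \<xi> \<omega> \<in> ?J)" using that by (intro prob_X) auto
        also have "\<dots> \<le> \<P>(\<omega> in M. 1 / 4 * real_of_int (x n) < \<bar>real_of_int (\<xi> \<omega>) - \<mu>\<bar>)"
        proof (rule finite_measure_mono)
          show "{\<omega> \<in> space M. \<xi> \<omega> \<in> ?J} \<subseteq> {\<omega> \<in> space M. 1 / 4 * real_of_int (x n) < \<bar>real_of_int (\<xi> \<omega>) - \<mu>\<bar>}"
            using J_big(2) elim(7) by fastforce
        qed measurable
        finally show ?thesis .
      qed
      have UC: "(\<Union>j\<in>{1..n} - {i}. ?C j) \<in> events"
        by (intro sets.finite_UN) (rule finite_Diff[OF finite_atLeastAtMost], rule C_events)
      have G: "?G \<in> events" by measurable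
      have B: "?B \<in> events" by measurable
      have "space M \<subseteq> ?G \<union> (?B \<union> (\<Union>j\<in>{1..n} - {i}. ?C j))"
      proof
        fix \<omega> assume "\<omega> \<in> space M"
        then show "\<omega> \<in> ?G \<union> (?B \<union> (\<Union>j\<in>{1..n} - {i}. ?C j))"
          unfolding Un_iff UN_iff mem_Collect_eq not_less[symmetric] by blast
      qed
      then have "prob (space M) \<le> prob (?G \<union> (?B \<union> (\<Union>j\<in>{1..n} - {i}. ?C j)))"
        by (rule finite_measure_mono) (rule sets.Un[OF G sets.Un[OF B UC]])
      also have "\<dots> \<le> prob ?G + prob (?B \<union> (\<Union>j\<in>{1..n} - {i}. ?C j))"
        by (rule measure_Un_le[OF G sets.Un[OF B UC]])
      also have "prob (?B \<union> (\<Union>j\<in>{1..n} - {i}. ?C j)) \<le> prob ?B + prob (\<Union>j\<in>{1..n} - {i}. ?C j)"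
        by (rule measure_Un_le[OF B UC])
      also have "prob (\<Union>j\<in>{1..n} - {i}. ?C j) \<le> (\<Sum>j\<in>{1..n} - {i}. prob (?C j))"
        by (rule finite_measure_subadditive_finite) (use C_events in blast)+
      also have "\<dots> \<le> (\<Sum>j\<in>{1..n} - {i}. \<P>(\<omega> in M. 1 / 4 * real_of_int (x n) < \<bar>real_of_int (\<xi> \<omega>) - \<mu>\<bar>))"
        by (intro sum_mono C_le)
      also have "\<dots> \<le> real n * \<P>(\<omega> in M. 1 / 4 * real_of_int (x n) < \<bar>real_of_int (\<xi> \<omega>) - \<mu>\<bar>)"
        using i by (simp only: sum_constant) (intro mult_right_mono, auto)
      also have "\<dots> \<le> \<rho>2 n" by (rule elim)
      also have "prob ?B \<le> \<rho>1 n" using elim(1) i by blast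
      finally have "1 - (\<rho>1 n + \<rho>2 n) \<le> prob ?G" unfolding prob_space by linarith
      then have "exp (- d) * p (x n) * (1 - (\<rho>1 n + \<rho>2 n)) \<le> exp (- d) * p (x n) * prob ?G"
        by (intro mult_left_mono) auto
      also have "\<dots> \<le> prob (?F i)"
      proof (intro jump_lower i)
        fix t assume "t \<in> ?R"
        then show "N n - t \<in> ?J" using target[of n] elim(4) by (simp add: algebra_simps)
      qed (use elim(3) in auto)
      finally show ?thesis .
    qed
    have "(exp (- d) * (1 - (\<rho>1 n + \<rho>2 n))) * (real n * p (x n)) = (\<Sum>i\<in>{1..n}. exp (- d) * p (x n) * (1 - (\<rho>1 n + \<rho>2 n)))"
      by simp
    also have "\<dots> \<le> (\<Sum>i\<in>{1..n}. prob (?F i))" by (intro sum_mono F_ge)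
    also have "\<dots> = prob (\<Union>i\<in>{1..n}. ?F i)"
      by (intro finite_measure_finite_Union[symmetric]) (auto simp: disjoint_family_on_def intro!: F_events)
    also have "\<dots> \<le> big_max_prob z n"
      unfolding big_max_prob_def
    proof (rule finite_measure_mono)
      show "(\<Union>i\<in>{1..n}. ?F i) \<subseteq> {\<omega> \<in> space M. z * real_of_int (x n) < real_of_int (partial_max X n \<omega>) \<and> partial_sum X n \<omega> = N n}"
        using J_big(1) by (auto simp: partial_max_greater_iff[OF elim(5)])
      show "{\<omega> \<in> space M. z * real_of_int (x n) < real_of_int (partial_max X n \<omega>) \<and> partial_sum X n \<omega> = N n} \<in> events"
        using elim(5) by measurable
    qed
    finally show ?case using elim by (simp add: pos_le_divide_eq)
  qed
  moreover have "(\<lambda>n. \<rho>1 n + \<rho>2 n) \<longlonglongrightarrow> 0" using tendsto_add[OF \<rho>1 \<rho>2] by simp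
  ultimately show ?thesis by blast
qed

lemma big_max_prob_below:
  assumes "0 < z" "z < 1"
  shows "(\<lambda>n. big_max_prob z n / (real n * p (x n))) \<longlonglongrightarrow> 1"
proof (rule order_tendstoI)
  fix a :: real assume a: "a < 1"
  \<comment> \<open>For positive \<open>a\<close> this makes \<open>exp (- d)\<close> the square
    root of \<open>a\<close>, strictly between \<open>a\<close> and 1; for other \<open>a\<close>
    any positive \<open>d\<close> works.\<close>
  define d where "d = (if a > 0 then - ln a / 2 else 1)"
  have d: "d > 0" "a < exp (- d)"
  proof -
    have "a < exp (- d)" if "a > 0"
    proof -
      have "ln a < ln a / 2" using that a by simp
      then have "exp (ln a) < exp (ln a / 2)" by (simp only: exp_less_mono)
      then show ?thesis using that by (simp add: d_def)
    qed
    then show "a < exp (- d)" by (cases "a > 0") (auto intro: le_less_trans[of _ 0])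
  qed (use a in \<open>auto simp: d_def\<close>)
  obtain \<rho> where \<rho>: "\<rho> \<longlonglongrightarrow> 0" "\<forall>\<^sub>F n in sequentially. exp (- d) * (1 - \<rho> n) \<le> big_max_prob z n / (real n * p (x n))"
    using big_max_prob_lower[OF assms d(1)] by auto
  have "(\<lambda>n. exp (- d) * (1 - \<rho> n)) \<longlonglongrightarrow> exp (- d) * (1 - 0)" by (intro tendsto_intros \<rho>)
  then have "\<forall>\<^sub>F n in sequentially. a < exp (- d) * (1 - \<rho> n)" using d by (intro order_tendstoD(1)) auto
  with \<rho>(2) show "\<forall>\<^sub>F n in sequentially. a < big_max_prob z n / (real n * p (x n))" by eventually_elim simp
next
  fix a :: real assume a: "1 < a"
  define d where "d = ln a / 2"
  have d: "d > 0" "exp d < a"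
  proof -
    have "ln a / 2 < ln a" using a by simp
    then have "exp (ln a / 2) < exp (ln a)" by (simp only: exp_less_mono)
    then show "exp d < a" using a by (simp add: d_def)
  qed (use a in \<open>auto simp: d_def\<close>)
  obtain \<rho> where \<rho>: "\<rho> \<longlonglongrightarrow> 0" "\<forall>\<^sub>F n in sequentially. big_max_prob z n / (real n * p (x n)) \<le> exp d + \<rho> n"
    using big_max_prob_upper[OF assms(1) d(1)] by auto
  have "(\<lambda>n. exp d + \<rho> n) \<longlonglongrightarrow> exp d + 0" by (intro tendsto_intros \<rho>)
  then have "\<forall>\<^sub>F n in sequentially. exp d + \<rho> n < a" using d by (intro order_tendstoD(2)) auto
  with \<rho>(2) show "\<forall>\<^sub>F n in sequentially. big_max_prob z n / (real n * p (x n)) < a" by eventually_elim simp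
qed

text \<open>An averaging argument. If all summands were at most \<open>z * x n\<close>, which is
  eventually at most \<open>\<mu>\<close>, their sum could not exceed \<open>n * \<mu>\<close>; but
  \<open>N n\<close> does exceed it as soon as \<open>x n \<ge> 2\<close> outweighs the rounding
  error.\<close>

lemma big_max_prob_negative:
  assumes "z < 0"
  shows "\<forall>\<^sub>F n in sequentially. big_max_prob z n = \<P>(\<omega> in M. partial_sum X n \<omega> = N n)"
  using eventually_x_ge[OF neg_0_less_iff_less[THEN iffD2, OF assms], of "\<bar>\<mu>\<bar>"] eventually_x_ge[OF zero_less_one, of 2] eventually_ge_at_top[of 1]
proof eventually_elim
  case (elim n)
  have "z * real_of_int (x n) < real_of_int (partial_max X n \<omega>)" if "partial_sum X n \<omega> = N n" for \<omega>
  proof (rule ccontr)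
    assume "\<not> z * real_of_int (x n) < real_of_int (partial_max X n \<omega>)"
    then have "real_of_int (X i \<omega>) \<le> z * real_of_int (x n)" if "i \<in> {1..n}" for i
      using that by (auto simp: partial_max_greater_iff[OF elim(3)] not_less)
    then have "(\<Sum>i=1..n. real_of_int (X i \<omega>)) \<le> (\<Sum>i=1..n. z * real_of_int (x n))" by (intro sum_mono)
    then have "real_of_int (N n) \<le> real n * (z * real_of_int (x n))"
      using that by (simp flip: that add: partial_sum_def)
    moreover have "real n * (z * real_of_int (x n)) \<le> real n * \<mu>"
      using elim(1) by (intro mult_left_mono) auto
    ultimately show False using target[of n] elim(2) by simp
  qed
  then show ?case unfolding big_max_prob_def by (metis (no_types, lifting))
qed

lemma big_max_prob_antimono:
  assumes "n \<ge> 1" "0 < x n" "z \<le> z'"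
  shows "big_max_prob z' n \<le> big_max_prob z n"
  unfolding big_max_prob_def
proof (rule finite_measure_mono)
  have "z * real_of_int (x n) \<le> z' * real_of_int (x n)" using assms by (intro mult_right_mono) auto
  then show "{\<omega> \<in> space M. z' * real_of_int (x n) < real_of_int (partial_max X n \<omega>) \<and> partial_sum X n \<omega> = N n} \<subseteq>
    {\<omega> \<in> space M. z * real_of_int (x n) < real_of_int (partial_max X n \<omega>) \<and> partial_sum X n \<omega> = N n}" by auto
  show "{\<omega> \<in> space M. z * real_of_int (x n) < real_of_int (partial_max X n \<omega>) \<and> partial_sum X n \<omega> = N n} \<in> events"
    using assms(1) by measurable
qed

text \<open>Positivity cannot be read off the limit \<open>s\<close>: a quotient with denominator 0
  has the value 0, which is compatible with \<open>s = 0\<close>. It holds because the event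
  contains a big-jump event whose probability is asymptotic to \<open>n * p (x n)\<close>.\<close>

lemma prob_target_pos: "\<forall>\<^sub>F n in sequentially. 0 < \<P>(\<omega> in M. partial_sum X n \<omega> = N n)"
proof -
  have "\<forall>\<^sub>F n in sequentially. 0 < big_max_prob (1/2) n / (real n * p (x n))"
    by (rule order_tendstoD(1)[OF big_max_prob_below]) auto
  then show ?thesis
    using p_x_pos
  proof eventually_elim
    case (elim n)
    have "0 \<le> real n * p (x n)" by simp
    with elim have "0 < big_max_prob (1/2) n" by (auto simp: zero_less_divide_iff simp del: zero_le_mult_iff)
    also have "\<dots> \<le> \<P>(\<omega> in M. partial_sum X n \<omega> = N n)"
      unfolding big_max_prob_def by (intro finite_measure_mono) auto
    finally show ?case .
  qed
qed

lemma cdf_cond_law: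
  assumes "n \<ge> 1" "0 < x n" and pos: "0 < \<P>(\<omega> in M. partial_sum X n \<omega> = N n)"
  shows "cdf (cond_law M (\<lambda>\<omega>. real_of_int (partial_max X n \<omega>) / real_of_int (x n)) (\<lambda>\<omega>. partial_sum X n \<omega> = N n)) z
    = 1 - big_max_prob z n / \<P>(\<omega> in M. partial_sum X n \<omega> = N n)"
proof -
  let ?A = "{\<omega> \<in> space M. partial_sum X n \<omega> = N n}"
  let ?Y = "\<lambda>\<omega>. real_of_int (partial_max X n \<omega>) / real_of_int (x n)"
  have Y [measurable]: "?Y \<in> borel_measurable M" using assms(1) by measurable
  have big: "{\<omega> \<in> space M. z * real_of_int (x n) < real_of_int (partial_max X n \<omega>) \<and> partial_sum X n \<omega> = N n} \<in> events"
    using assms(1) by measurable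
  have "cdf (cond_law M ?Y (\<lambda>\<omega>. partial_sum X n \<omega> = N n)) z = measure (uniform_measure M ?A) {\<omega> \<in> space M. ?Y \<omega> \<le> z}"
    unfolding cdf_def cond_law_def using Y
    by (subst measure_distr) (auto simp: vimage_def Int_def conj_commute intro!: arg_cong[where f="measure _"])
  also have "\<dots> = prob (?A \<inter> {\<omega> \<in> space M. ?Y \<omega> \<le> z}) / prob ?A"
    by (rule measure_uniform_measure) (use pos in \<open>auto simp: emeasure_eq_measure\<close>)
  also have "?A \<inter> {\<omega> \<in> space M. ?Y \<omega> \<le> z} = ?A - {\<omega> \<in> space M. z * real_of_int (x n) < real_of_int (partial_max X n \<omega>) \<and> partial_sum X n \<omega> = N n}"
    using assms(2) by (auto simp: pos_divide_le_eq)
  also have "prob \<dots> = prob ?A - big_max_prob z n"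
    unfolding big_max_prob_def by (intro finite_measure_Diff big) auto
  finally show ?thesis using pos by (simp add: diff_divide_distrib)
qed

end

section \<open>Weak convergence\<close>

text \<open>Comparing \<open>V y / y\<close> at \<open>u n\<close> and \<open>a n\<close> leaves the
  factor \<open>a n / u n\<close>, which tends to 0, times the normalised quantity at
  \<open>a n\<close>, which tends to 1 by the choice of \<open>a\<close>.\<close>

lemma normalised_second_moment_tendsto_0:
  fixes V :: "real \<Rightarrow> real" and a u :: "nat \<Rightarrow> real"
  assumes ratio: "\<And>y w. y0 \<le> y \<Longrightarrow> y \<le> w \<Longrightarrow> V w / w \<le> 3 / 2 * (V y / y)"
    and V_nonneg: "\<And>y. 0 \<le> V y"
    and a: "filterlim a at_top sequentially"
    and norming: "(\<lambda>n. V (a n) / (a n)\<^sup>2) \<sim>[sequentially] (\<lambda>n. 1 / real n)"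
    and u: "filterlim (\<lambda>n. u n / a n) at_top sequentially"
  shows "(\<lambda>n. real n * (V (u n) / (u n)\<^sup>2)) \<longlonglongrightarrow> 0"
proof (rule Lim_null_comparison)
  let ?K = "\<lambda>n. 3 / 2 * (real n * (V (a n) / (a n)\<^sup>2)) * inverse (u n / a n)"
  show "\<forall>\<^sub>F n in sequentially. norm (real n * (V (u n) / (u n)\<^sup>2)) \<le> ?K n"
    using filterlim_at_top_dense[THEN iffD1, OF a, rule_format, of "max y0 0"]
      filterlim_at_top_dense[THEN iffD1, OF u, rule_format, of 1]
  proof eventually_elim
    case (elim n)
    then have pos: "0 < a n" "a n \<le> u n" "0 < u n" "y0 \<le> a n" by (auto simp: field_simps)
    have "V (u n) / (u n)\<^sup>2 = V (u n) / u n / u n" by (simp add: power2_eq_square)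
    also have "\<dots> \<le> 3 / 2 * (V (a n) / a n) / u n"
      using pos by (intro divide_right_mono ratio) auto
    finally have "real n * (V (u n) / (u n)\<^sup>2) \<le> real n * (3 / 2 * (V (a n) / a n) / u n)"
      by (intro mult_left_mono) auto
    also have "\<dots> = ?K n" using pos by (simp add: field_simps power2_eq_square)
    finally show ?case using V_nonneg[of "u n"] by simp
  qed
  \<comment> \<open>Asymptotic equivalence counts 0/0 as 1; this exceptional branch can occur only
    at \<open>n = 0\<close>.\<close>
  have "(\<lambda>n. if V (a n) / (a n)\<^sup>2 = 0 \<and> 1 / real n = 0 then 1 else V (a n) / (a n)\<^sup>2 / (1 / real n)) \<longlonglongrightarrow> 1"
    using norming by (simp add: asymp_equiv_def)
  moreover have "\<forall>\<^sub>F n in sequentially. (if V (a n) / (a n)\<^sup>2 = 0 \<and> 1 / real n = 0 then 1 else V (a n) / (a n)\<^sup>2 / (1 / real n))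
      = real n * (V (a n) / (a n)\<^sup>2)"
    using eventually_gt_at_top[of 0] by eventually_elim auto
  ultimately have "(\<lambda>n. real n * (V (a n) / (a n)\<^sup>2)) \<longlonglongrightarrow> 1"
    by (rule Lim_transform_eventually)
  then have "?K \<longlonglongrightarrow> 3 / 2 * 1 * 0"
    by (intro tendsto_mult tendsto_const tendsto_inverse_0_at_top[OF u])
  then show "?K \<longlonglongrightarrow> 0" by simp
qed

section \<open>Deviation bounds and almost monotonicity for the sequence\<close>

context iid_int_sequence
begin

lemma sum_except_deviation:
  fixes u :: "nat \<Rightarrow> real" and \<mu> :: real
  defines "V \<equiv> truncated_variance M \<xi>"
  assumes int: "integrable M (\<lambda>\<omega>. real_of_int (\<xi> \<omega>))" and \<mu>: "\<mu> = (\<integral>\<omega>. real_of_int (\<xi> \<omega>) \<partial>M)"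
    and doubling: "\<And>y. y0 \<le> y \<Longrightarrow> V (2 * y) \<le> 3 / 2 * V y" and y0: "0 < y0" and y: "y0 \<le> y"
    and r: "r = real n * (V y / y\<^sup>2)"
  shows "i \<in> {1..n} \<Longrightarrow> \<P>(\<omega> in M. y < \<bar>real_of_int (sum_except n i \<omega>) - (real n - 1) * \<mu>\<bar>) \<le> 7 * r + 36 * r\<^sup>2"
    and "real n * \<P>(\<omega> in M. y < \<bar>real_of_int (\<xi> \<omega>) - \<mu>\<bar>) \<le> 7 * r + 36 * r\<^sup>2"
proof -
  define Y0 where "Y0 \<omega> = real_of_int (\<xi> \<omega>) - \<mu>" for \<omega>
  define Y where "Y j \<omega> = real_of_int (X j \<omega>) - \<mu>" for j \<omega>
  have V_eq: "V v = (\<integral>\<omega>. (Y0 \<omega>)\<^sup>2 * indicator {\<omega>. \<bar>Y0 \<omega>\<bar> \<le> v} \<omega> \<partial>M)" for v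
    unfolding V_def truncated_variance_def Let_def \<mu>[symmetric] Y0_def ..
  have intY: "integrable M Y0" unfolding Y0_def using int by simp
  have meanY: "(\<integral>\<omega>. Y0 \<omega> \<partial>M) = 0" unfolding Y0_def using int \<mu> by (simp add: prob_space)
  have y_pos: "0 < y" using y y0 by simp
  have tail: "(\<integral>\<omega>. \<bar>Y0 \<omega>\<bar> * indicator {\<omega>. y < \<bar>Y0 \<omega>\<bar>} \<omega> \<partial>M) \<le> 6 * (V y / y)"
    unfolding V_eq by (rule truncated_mean_tail_le[OF intY _ y0 y]) (use doubling in \<open>simp add: V_eq\<close>)
  have "0 \<le> V y" unfolding V_eq by (intro integral_nonneg_AE) auto
  then have r_nonneg: "0 \<le> r" unfolding r by simp
  show "real n * \<P>(\<omega> in M. y < \<bar>real_of_int (\<xi> \<omega>) - \<mu>\<bar>) \<le> 7 * r + 36 * r\<^sup>2"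
  proof -
    have "real n * \<P>(\<omega> in M. y < \<bar>Y0 \<omega>\<bar>) \<le> real n * (6 * (V y / y\<^sup>2))"
      by (intro mult_left_mono tail_le_truncated_second_moment[OF intY y_pos tail]) auto
    also have "\<dots> = 6 * r" unfolding r by simp
    \<comment> \<open>Relaxed to the bound for the sums, so that one null sequence serves both
      halves of \<open>deviation\<close>.\<close>
    also have "\<dots> \<le> 7 * r + 36 * r\<^sup>2" using r_nonneg by simp
    finally show ?thesis by (simp add: Y0_def)
  qed
  assume i: "i \<in> {1..n}"
  have ident: "distr M borel (Y j) = distr M borel Y0" if "j \<in> {1..n} - {i}" for j
  proof -
    have [measurable]: "X j \<in> measurable M (count_space UNIV)" using that by simp
    have "distr (distr M (count_space UNIV) (X j)) borel (\<lambda>k. real_of_int k - \<mu>) =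
        distr (distr M (count_space UNIV) \<xi>) borel (\<lambda>k. real_of_int k - \<mu>)"
      using iid that by (simp add: iid_copies_def)
    then show ?thesis unfolding Y_def Y0_def by (subst (asm) (1 2) distr_distr) (auto simp: comp_def)
  qed
  have indY: "indep_vars (\<lambda>_. borel) Y ({1..n} - {i})"
    unfolding Y_def
    by (rule indep_vars_compose2[OF indep_vars_subset[OF indep[of n]], where Y="\<lambda>_ k. real_of_int k - \<mu>"]) auto
  have "\<P>(\<omega> in M. y < \<bar>\<Sum>j\<in>{1..n} - {i}. Y j \<omega>\<bar>) \<le> 7 * r + 36 * r\<^sup>2"
    by (rule iid_sum_tail_le[where n=n, OF indY _ _ ident intY meanY y_pos])
      (use tail r i in \<open>auto simp: V_eq\<close>)
  moreover have "(\<Sum>j\<in>{1..n} - {i}. Y j \<omega>) = real_of_int (sum_except n i \<omega>) - (real n - 1) * \<mu>" for \<omega>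
    using i by (simp add: Y_def sum_except_def sum_subtractf of_nat_diff)
  ultimately show "\<P>(\<omega> in M. y < \<bar>real_of_int (sum_except n i \<omega>) - (real n - 1) * \<mu>\<bar>) \<le> 7 * r + 36 * r\<^sup>2"
    by simp
qed

text \<open>A bound on the quotient is a bound on \<open>p\<close> only where the denominator is
  positive, which intermediate regular variation ensures far out.\<close>

lemma almost_decreasing:
  assumes irv: "intermediate_regularly_varying (\<lambda>y. p \<lfloor>y\<rfloor>)"
    and sup: "Limsup at_top (\<lambda>k. ereal ((SUP y\<in>{k..}. p y) / p k)) < \<infinity>"
  shows "\<exists>T C. \<forall>y\<ge>T. \<forall>w\<ge>y. p \<lfloor>w::real\<rfloor> \<le> C * p \<lfloor>y\<rfloor>"
proof -
  obtain C where C: "Limsup at_top (\<lambda>k. ereal ((SUP y\<in>{k..}. p y) / p k)) < ereal C"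
    using ereal_dense2[OF sup] by (elim exE conjE) (rule that)
  obtain k0 :: int where k0: "\<And>k. k0 \<le> k \<Longrightarrow> (SUP y\<in>{k..}. p y) / p k < C"
    using Limsup_lessD[OF C] by (auto simp: eventually_at_top_linorder)
  obtain T where T: "\<And>y::real. T \<le> y \<Longrightarrow> 0 < p \<lfloor>y\<rfloor>"
    using irv by (auto simp: intermediate_regularly_varying_def eventually_at_top_linorder)
  have bdd: "bdd_above (p ` A)" for A
    by (rule bdd_aboveI[of _ 1]) (auto simp: p_def)
  have "p \<lfloor>w\<rfloor> \<le> C * p \<lfloor>y\<rfloor>" if "max T (real_of_int k0) \<le> y" "y \<le> w" for y w :: real
  proof -
    have "k0 \<le> \<lfloor>y\<rfloor>" using that by (simp add: le_floor_iff)
    then have "(SUP j\<in>{\<lfloor>y\<rfloor>..}. p j) / p \<lfloor>y\<rfloor> < C" by (rule k0)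
    then have "(SUP j\<in>{\<lfloor>y\<rfloor>..}. p j) \<le> C * p \<lfloor>y\<rfloor>"
      using T[of y] that by (simp add: pos_divide_less_eq)
    moreover have "p \<lfloor>w\<rfloor> \<le> (SUP j\<in>{\<lfloor>y\<rfloor>..}. p j)"
      using floor_mono[OF that(2)] by (intro cSUP_upper bdd) auto
    ultimately show ?thesis by simp
  qed
  then show ?thesis by blast
qed

end

lemma cdf_two_point_mixture:
  assumes "s \<in> {0..1}"
  shows "cdf (two_point_mixture s u v) z = (1 - s) * indicator {u..} z + s * indicator {v..} z"
proof -
  have "emeasure (two_point_mixture s u v) {..z} = ennreal ((1 - s) * indicator {u..} z + s * indicator {v..} z)"
    using assms by (subst emeasure_two_point_mixture) (auto simp: indicator_def simp flip: ennreal_plus)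
  then show ?thesis using assms by (simp add: cdf_def measure_def del: ennreal_plus)
qed

text \<open>Detects missing atoms: applied to the limit distribution function at 0 and at 1,
  continuity forces \<open>s = 1\<close> and \<open>s = 0\<close> respectively.\<close>

lemma isCont_eq_of_left:
  fixes G :: "real \<Rightarrow> real"
  assumes "isCont G z" and "b < z" and "\<And>v. b < v \<Longrightarrow> v < z \<Longrightarrow> G v = k"
  shows "G z = k"
proof (rule tendsto_unique)
  show "(G \<longlongrightarrow> G z) (at_left z)"
    using assms(1) by (simp add: isCont_def tendsto_within_subset filterlim_at_split)
  have "\<forall>\<^sub>F v in at_left z. G v = k"
    using eventually_at_left_real[OF assms(2)] by eventually_elim (use assms(3) in auto)
  then show "(G \<longlongrightarrow> k) (at_left z)" by (rule tendsto_eventually)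
qed simp

context one_big_jump
begin

text \<open>Away from 0 and 1 the limits follow from the big-maximum asymptotics. At these two
  points the missing atom determines \<open>s\<close>, the value at 1/2 already tends to 0 or to 1,
  and monotonicity of distribution functions carries this over.\<close>

lemma weak_conv_partial_max:
  assumes x_pos: "\<And>n. n \<ge> 1 \<Longrightarrow> 0 < x n" and s: "s \<in> {0..1}"
    and lim: "(\<lambda>n. real n * p (x n) / \<P>(\<omega> in M. partial_sum X n \<omega> = N n)) \<longlonglongrightarrow> s"
  shows "weak_conv_m (\<lambda>n. cond_law M (\<lambda>\<omega>. real_of_int (partial_max X n \<omega>) / real_of_int (x n))
    (\<lambda>\<omega>. partial_sum X n \<omega> = N n)) (two_point_mixture s 0 1)"
proof -
  let ?A = "\<lambda>n. \<P>(\<omega> in M. partial_sum X n \<omega> = N n)"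
  let ?F = "\<lambda>n. cdf (cond_law M (\<lambda>\<omega>. real_of_int (partial_max X n \<omega>) / real_of_int (x n)) (\<lambda>\<omega>. partial_sum X n \<omega> = N n))"
  let ?G = "cdf (two_point_mixture s 0 1)"
  have eq: "\<forall>\<^sub>F n in sequentially. \<forall>z. ?F n z = 1 - big_max_prob z n / ?A n"
    using prob_target_pos eventually_ge_at_top[of 1]
    by eventually_elim (use x_pos cdf_cond_law in blast)
  have transfer: "(\<lambda>n. ?F n z) \<longlonglongrightarrow> 1 - l * s" if "(\<lambda>n. big_max_prob z n / (real n * p (x n))) \<longlonglongrightarrow> l" for z l
  proof (rule Lim_transform_eventually)
    show "(\<lambda>n. 1 - big_max_prob z n / (real n * p (x n)) * (real n * p (x n) / ?A n)) \<longlonglongrightarrow> 1 - l * s"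
      by (intro tendsto_intros that lim)
    show "\<forall>\<^sub>F n in sequentially. 1 - big_max_prob z n / (real n * p (x n)) * (real n * p (x n) / ?A n) = ?F n z"
      using eq p_x_pos eventually_ge_at_top[of 1] by eventually_elim simp
  qed
  have below: "(\<lambda>n. ?F n z) \<longlonglongrightarrow> 1 - s" if "0 < z" "z < 1" for z
    using transfer[OF big_max_prob_below[OF that]] by simp
  have bounds: "\<forall>\<^sub>F n in sequentially. \<forall>z z'. z \<le> z' \<longrightarrow> 0 \<le> ?F n z \<and> ?F n z \<le> ?F n z' \<and> ?F n z' \<le> 1"
    using eq prob_target_pos eventually_ge_at_top[of 1]
  proof eventually_elim
    case (elim n)
    have "big_max_prob z n \<le> ?A n" "0 \<le> big_max_prob z n" for z
      unfolding big_max_prob_def by (auto intro!: finite_measure_mono)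
    then show ?case using elim(1,2) big_max_prob_antimono[OF elim(3) x_pos[OF elim(3)]]
      by (auto simp: divide_right_mono pos_divide_le_eq)
  qed
  show ?thesis
    unfolding weak_conv_m_def weak_conv_def
  proof (intro allI impI)
    fix z assume cont: "isCont ?G z"
    note G = cdf_two_point_mixture[OF s]
    consider "z < 0" | "z = 0" | "0 < z" "z < 1" | "z = 1" | "1 < z" by linarith
    then show "(\<lambda>n. ?F n z) \<longlonglongrightarrow> ?G z"
    proof cases
      case 1
      have "\<forall>\<^sub>F n in sequentially. ?F n z = 0"
        using eq prob_target_pos big_max_prob_negative[OF 1] by eventually_elim simp
      moreover have "?G z = 0" using 1 by (simp add: G)
      ultimately show ?thesis by (simp add: tendsto_eventually)
    next
      case 2
      have "?G z = 0"
        by (rule isCont_eq_of_left[OF cont, of "-1"]) (use 2 in \<open>auto simp: G\<close>)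
      then have "s = 1" using 2 by (simp add: G)
      have "(\<lambda>n. ?F n z) \<longlonglongrightarrow> 0"
      proof (rule tendsto_sandwich[OF _ _ tendsto_const])
        show "\<forall>\<^sub>F n in sequentially. 0 \<le> ?F n z" using bounds by eventually_elim blast
        show "\<forall>\<^sub>F n in sequentially. ?F n z \<le> ?F n (1/2)" using bounds by eventually_elim (simp add: 2)
        show "(\<lambda>n. ?F n (1/2)) \<longlonglongrightarrow> 0" using below[of "1/2"] \<open>s = 1\<close> by simp
      qed
      then show ?thesis using \<open>?G z = 0\<close> by simp
    next
      case 3
      then show ?thesis using below by (simp add: G)
    next
      case 4
      have "?G z = 1 - s"
        by (rule isCont_eq_of_left[OF cont, of 0]) (use 4 in \<open>auto simp: G\<close>)
      then have "s = 0" using 4 by (simp add: G)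
      have "?G z = 1" using 4 by (simp add: G)
      have "(\<lambda>n. ?F n z) \<longlonglongrightarrow> 1"
      proof (rule tendsto_sandwich[OF _ _ _ tendsto_const])
        show "\<forall>\<^sub>F n in sequentially. ?F n (1/2) \<le> ?F n z" using bounds by eventually_elim (simp add: 4)
        show "\<forall>\<^sub>F n in sequentially. ?F n z \<le> 1" using bounds by eventually_elim blast
        show "(\<lambda>n. ?F n (1/2)) \<longlonglongrightarrow> 1" using below[of "1/2"] \<open>s = 0\<close> by simp
      qed
      then show ?thesis using \<open>?G z = 1\<close> by simp
    next
      case 5
      then show ?thesis using transfer[OF big_max_prob_beyond[OF 5]] 5 by (simp add: G)
    qed
  qed
qed

end

theorem corollary2p22:
  fixes M :: "'a measure"
    and \<xi> :: "'a \<Rightarrow> int"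
    and X :: "nat \<Rightarrow> 'a \<Rightarrow> int"
    and \<mu> s :: real
    and a b :: "nat \<Rightarrow> real"
    and x :: "nat \<Rightarrow> int"
  assumes "prob_space M"
    and "\<xi> \<in> measurable M (count_space UNIV)"
    and "iid_copies M \<xi> X"
    and "integrable M (\<lambda>\<omega>. real_of_int (\<xi> \<omega>))"
    and "\<mu> = (\<integral>\<omega>. real_of_int (\<xi> \<omega>) \<partial>M)"
    and "slowly_varying (truncated_variance M \<xi>)"
    and "\<And>n. n \<ge> 1 \<Longrightarrow> 0 < a n"
    and "filterlim a at_top sequentially"
    and "(\<lambda>n. truncated_variance M \<xi> (a n) / (a n)\<^sup>2) \<sim>[sequentially] (\<lambda>n. 1 / real n)"
    and "\<And>n. b n = real n * \<mu>"
    and "intermediate_regularly_varying (\<lambda>y. \<P>(\<omega> in M. \<xi> \<omega> = \<lfloor>y\<rfloor>))"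
    and "Limsup at_top (\<lambda>k::int. ereal ((SUP y\<in>{k..}. \<P>(\<omega> in M. \<xi> \<omega> = y)) / \<P>(\<omega> in M. \<xi> \<omega> = k))) < \<infinity>"
    and "\<And>n. n \<ge> 1 \<Longrightarrow> 0 < x n"
    and "filterlim (\<lambda>n. real_of_int (x n) / a n) at_top sequentially"
    and "s \<in> {0..1}"
    and "(\<lambda>n. real n * \<P>(\<omega> in M. \<xi> \<omega> = x n) / \<P>(\<omega> in M. partial_sum X n \<omega> - \<lfloor>b n\<rfloor> = x n))
           \<longlonglongrightarrow> s"
  shows "weak_conv_m
           (\<lambda>n. cond_law M (\<lambda>\<omega>. real_of_int (partial_max X n \<omega>) / real_of_int (x n))
                  (\<lambda>\<omega>. partial_sum X n \<omega> - \<lfloor>b n\<rfloor> = x n))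
           (two_point_mixture s 0 1)"
proof -
  interpret prob_space M by fact
  interpret iid_int_sequence M \<xi> X
    using assms(2,3) by unfold_locales
  define V where "V = truncated_variance M \<xi>"
  have rv: "(\<lambda>\<omega>. real_of_int (\<xi> \<omega>) - \<mu>) \<in> borel_measurable M" by measurable
  have V_eq: "V y = (\<integral>\<omega>. (real_of_int (\<xi> \<omega>) - \<mu>)\<^sup>2 * indicator {\<omega>. \<bar>real_of_int (\<xi> \<omega>) - \<mu>\<bar> \<le> y} \<omega> \<partial>M)" for y
    unfolding V_def truncated_variance_def Let_def assms(5)[symmetric] ..
  have V_nonneg: "0 \<le> V y" for y unfolding V_eq by (intro integral_nonneg_AE) auto
  have "\<forall>\<^sub>F y in at_top. V (2 * y) / V y < 3 / 2"
    using assms(6) by (intro order_tendstoD(2)[where y=1]) (auto simp: slowly_varying_def V_def)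
  moreover have "\<forall>\<^sub>F y in at_top. 0 < V y" using assms(6) by (simp add: slowly_varying_def V_def)
  ultimately have "\<forall>\<^sub>F y in at_top. V (2 * y) \<le> 3 / 2 * V y"
    by eventually_elim (simp add: pos_divide_less_eq)
  then obtain y1 where y1: "\<And>y. y1 \<le> y \<Longrightarrow> V (2 * y) \<le> 3 / 2 * V y" by (auto simp: eventually_at_top_linorder)
  define y0 where "y0 = max y1 1"
  have y0: "0 < y0" "\<And>y. y0 \<le> y \<Longrightarrow> V (2 * y) \<le> 3 / 2 * V y" using y1 by (auto simp: y0_def)
  have ratio: "V w / w \<le> 3 / 2 * (V y / y)" if "y0 \<le> y" "y \<le> w" for y w
    unfolding V_eq by (rule truncated_second_moment_le[OF _ y0(1) that rv]) (use y0(2) in \<open>simp add: V_eq\<close>)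
  have x_at_top: "filterlim (\<lambda>n. real_of_int (x n)) at_top sequentially"
  proof (rule filterlim_cong[THEN iffD1, OF refl refl])
    show "filterlim (\<lambda>n. real_of_int (x n) / a n * a n) at_top sequentially"
      by (rule filterlim_at_top_mult_at_top[OF assms(14,8)])
    show "\<forall>\<^sub>F n in sequentially. real_of_int (x n) / a n * a n = real_of_int (x n)"
      using eventually_ge_at_top[of 1] by eventually_elim (use assms(7) in \<open>fastforce simp: less_le\<close>)
  qed
  have p_fold: "p = (\<lambda>k. \<P>(\<omega> in M. \<xi> \<omega> = k))" by (simp add: p_def fun_eq_iff)
  have irv: "intermediate_regularly_varying (\<lambda>y. p \<lfloor>y\<rfloor>)" using assms(11) by (simp add: p_def)
  have meas: "(\<lambda>y::real. p \<lfloor>y\<rfloor>) \<in> borel_measurable borel"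
    by (rule measurable_compose[OF measurable_real_floor]) simp
  obtain T0 C0 where almost: "\<And>y w::real. T0 \<le> y \<Longrightarrow> y \<le> w \<Longrightarrow> p \<lfloor>w\<rfloor> \<le> C0 * p \<lfloor>y\<rfloor>"
    using almost_decreasing[OF irv] assms(12) unfolding p_fold by blast
  interpret one_big_jump M \<xi> X x "\<lambda>n. \<lfloor>b n\<rfloor> + x n" \<mu>
  proof unfold_locales
    show "\<bar>real_of_int (\<lfloor>b n\<rfloor> + x n) - real_of_int (x n) - real n * \<mu>\<bar> \<le> 1" for n
      unfolding assms(10) by simp linarith
    show "filterlim (\<lambda>n. real_of_int (x n)) at_top sequentially" by fact
    show "\<exists>r>1::real. \<exists>T>0. \<forall>y\<ge>T. \<forall>w\<ge>T. y / r \<le> w \<and> w \<le> r * y \<longrightarrow> 0 < p \<lfloor>y\<rfloor> \<and> p \<lfloor>w\<rfloor> \<le> exp d * p \<lfloor>y\<rfloor>"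
      if "d > 0" for d
      by (rule intermediate_regularly_varying_uniform[OF meas irv that])
    show "\<exists>C>0. \<exists>T>0. \<forall>y\<ge>T. \<forall>w\<ge>c * y. p \<lfloor>w\<rfloor> \<le> C * p \<lfloor>y\<rfloor>" if "c > 0" for c :: real
      by (rule intermediate_regularly_varying_dominated[OF meas irv almost that])
    \<comment> \<open>The weak law is applied at the level \<open>c * x n\<close>, which still
      dominates \<open>a n\<close> for every fixed positive \<open>c\<close>.\<close>
    fix c :: real assume c: "c > 0"
    define r where "r n = real n * (V (c * x n) / (c * x n)\<^sup>2)" for n
    have "filterlim (\<lambda>n. c * (real_of_int (x n) / a n)) at_top sequentially"
      by (rule filterlim_tendsto_pos_mult_at_top[OF tendsto_const c assms(14)])
    then have r: "r \<longlonglongrightarrow> 0"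
      unfolding r_def using assms(9) unfolding V_def[symmetric]
      by (intro normalised_second_moment_tendsto_0[OF ratio V_nonneg assms(8)]) simp_all
    have "(\<lambda>n. 7 * r n + 36 * (r n)\<^sup>2) \<longlonglongrightarrow> 7 * 0 + 36 * 0\<^sup>2" by (intro tendsto_intros r)
    moreover have "\<forall>\<^sub>F n in sequentially. y0 / c \<le> real_of_int (x n)"
      using x_at_top by (simp add: filterlim_at_top)
    then have "\<forall>\<^sub>F n in sequentially.
      (\<forall>i\<in>{1..n}. \<P>(\<omega> in M. c * x n < \<bar>real_of_int (sum_except n i \<omega>) - (real n - 1) * \<mu>\<bar>) \<le> 7 * r n + 36 * (r n)\<^sup>2) \<and>
      real n * \<P>(\<omega> in M. c * x n < \<bar>real_of_int (\<xi> \<omega>) - \<mu>\<bar>) \<le> 7 * r n + 36 * (r n)\<^sup>2"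
    proof eventually_elim
      case (elim n)
      then have ge: "y0 \<le> c * x n" using c by (simp add: pos_divide_le_eq mult.commute)
      show ?case
        using sum_except_deviation[OF assms(4,5) y0(2)[unfolded V_def] y0(1) ge r_def[unfolded V_def]]
        by blast
    qed
    ultimately show "\<exists>\<rho>. \<rho> \<longlonglongrightarrow> 0 \<and> (\<forall>\<^sub>F n in sequentially.
      (\<forall>i\<in>{1..n}. \<P>(\<omega> in M. c * x n < \<bar>real_of_int (sum_except n i \<omega>) - (real n - 1) * \<mu>\<bar>) \<le> \<rho> n) \<and>
      real n * \<P>(\<omega> in M. c * x n < \<bar>real_of_int (\<xi> \<omega>) - \<mu>\<bar>) \<le> \<rho> n)"
      by (intro exI[of _ "\<lambda>n. 7 * r n + 36 * (r n)\<^sup>2"]) simp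
  qed
  have event: "partial_sum X n \<omega> - \<lfloor>b n\<rfloor> = x n \<longleftrightarrow> partial_sum X n \<omega> = \<lfloor>b n\<rfloor> + x n" for n \<omega> by linarith
  show ?thesis
    using weak_conv_partial_max[OF assms(13,15)] assms(16) by (simp only: event p_fold)
qed

end
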